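(* Suppose $n>2$. Then the Jacobson radical of $\mathcal{V}_n$ is strictly contained in the two-sided ideal generated by $e_1$: $\mathrm{J}(\mathcal{V}_n)\subsetneq(e_1)$.
   Context: For $n\ge 1$, the degenerate affine periplectic Brauer algebra $\mathcal{V}_n$ is the unital associative $\mathbb{C}$-algebra with generators $s_i,e_i$ ($1\le i\le n-1$) and $y_j$ ($1\le j\le n$) and relations (for all indices for which the expressions make sense): $s_i^2=1$; $s_is_j=s_js_i$, $s_ie_j=e_js_i$, $e_ie_j=e_je_i$ if $|i-j|>1$; $s_is_{i+1}s_i=s_{i+1}s_is_{i+1}$; $y_iy_j=y_jy_i$; $e_iy_j=y_je_i$ and $s_iy_j=y_js_i$ if $j\ne i,i+1$; $e_{i+1}e_ie_{i+1}=-e_{i+1}$; $e_ie_{i+1}e_i=-e_i$; $e_is_i=e_i$; $s_ie_i=-e_i$; $s_ie_{i+1}e_i=s_{i+1}e_i$; $s_{i+1}e_ie_{i+1}=-s_ie_{i+1}$; $e_{i+1}e_is_{i+1}=e_{i+1}s_i$; $e_ie_{i+1}s_i=-e_is_{i+1}$; $e_i^2=0$; $s_iy_i-y_{i+1}s_i=-e_i-1$; $y_is_i-s_iy_{i+1}=e_i-1$; $e_i(y_i-y_{i+1})=-e_i$; $(y_i-y_{i+1})e_i=e_i$. The Jacobson radical $\mathrm{J}(A)$ of an associative algebra $A$ is the intersection of all maximal left ideals of $A$. *)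

theory Defs
  imports Complex_Main "HOL-Algebra.QuotRing" "HOL-Library.Poly_Mapping"
begin

section \<open>Left ideals and the Jacobson radical\<close>

text \<open>
  In a unital algebra every left (or two-sided) ideal of the underlying ring is automatically closed
  under scalars, because \<open>c x = (c 1) x\<close>. So the ring-theoretic notions below, and the two-sided
  \<open>Idl\<close> of HOL-Algebra, agree with the algebra-theoretic ones.
\<close>

locale left_ideal = additive_subgroup I R + ring R for I and R (structure) +
  assumes I_l_closed: "\<lbrakk>a \<in> I; x \<in> carrier R\<rbrakk> \<Longrightarrow> x \<otimes> a \<in> I"

locale maximal_left_ideal = left_ideal +
  assumes I_notcarr: "carrier R \<noteq> I"
    and I_maximal: "\<lbrakk>left_ideal J R; I \<subseteq> J; J \<subseteq> carrier R\<rbrakk> \<Longrightarrow> J = I \<or> J = carrier R"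

definition jacobson_radical :: "('a, 'b) ring_scheme \<Rightarrow> 'a set" where
  "jacobson_radical R = {x \<in> carrier R. \<forall>M. maximal_left_ideal M R \<longrightarrow> x \<in> M}"


section \<open>Free associative algebras over the complex numbers\<close>

text \<open>
  Words form a monoid under concatenation, written additively since the monoid algebra
  multiplication on \<open>\<Rightarrow>\<^sub>0\<close> expects an additive exponent monoid. A separate type
  avoids giving \<open>list\<close> itself a global additive structure.
\<close>

datatype 'x free_monoid = Word (letters: "'x list")

instantiation free_monoid :: (type) monoid_add
begin

definition zero_free_monoid :: "'a free_monoid" where
  "0 = Word []"

definition plus_free_monoid :: "'a free_monoid \<Rightarrow> 'a free_monoid \<Rightarrow> 'a free_monoid" where
  "u + v = Word (letters u @ letters v)"

instance
  by standard (simp_all add: zero_free_monoid_def plus_free_monoid_def)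

end

definition free_algebra :: "'x set \<Rightarrow> ('x free_monoid \<Rightarrow>\<^sub>0 complex) ring" where
  "free_algebra A =
    \<lparr>carrier = {f. \<forall>w \<in> Poly_Mapping.keys f. set (letters w) \<subseteq> A},
     mult = (*), one = 1, zero = 0, add = (+)\<rparr>"

abbreviation free_var :: "'x \<Rightarrow> 'x free_monoid \<Rightarrow>\<^sub>0 complex" where
  "free_var x \<equiv> Poly_Mapping.single (Word [x]) 1"

lemma ring_free_algebra: "ring (free_algebra A)"
proof (intro ringI abelian_groupI monoidI)
  fix f g
  assume "f \<in> carrier (free_algebra A)" "g \<in> carrier (free_algebra A)"
  then show "f \<oplus>\<^bsub>free_algebra A\<^esub> g \<in> carrier (free_algebra A)"
      and "f \<otimes>\<^bsub>free_algebra A\<^esub> g \<in> carrier (free_algebra A)"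
    using keys_add[of f g] keys_mult[of f g]
    by (fastforce simp: free_algebra_def plus_free_monoid_def)+
next
  fix f
  assume "f \<in> carrier (free_algebra A)"
  then show "\<exists>g \<in> carrier (free_algebra A).
      g \<oplus>\<^bsub>free_algebra A\<^esub> f = \<zero>\<^bsub>free_algebra A\<^esub>"
    by (intro bexI[of _ "- f"]) (auto simp: free_algebra_def)
qed (auto simp: free_algebra_def zero_free_monoid_def algebra_simps)


section \<open>The degenerate affine periplectic Brauer algebra\<close>

datatype generator = S nat | E nat | Y nat

definition generators :: "nat \<Rightarrow> generator set" where
  "generators n = S ` {1..<n} \<union> E ` {1..<n} \<union> Y ` {1..n}"

abbreviation gs :: "nat \<Rightarrow> generator free_monoid \<Rightarrow>\<^sub>0 complex" where
  "gs i \<equiv> free_var (S i)"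

abbreviation ge :: "nat \<Rightarrow> generator free_monoid \<Rightarrow>\<^sub>0 complex" where
  "ge i \<equiv> free_var (E i)"

abbreviation gy :: "nat \<Rightarrow> generator free_monoid \<Rightarrow>\<^sub>0 complex" where
  "gy j \<equiv> free_var (Y j)"

text \<open>A pair \<open>(a, b)\<close> in the following set stands for the relation \<open>a = b\<close>.\<close>

inductive_set relations ::
    "nat \<Rightarrow> ((generator free_monoid \<Rightarrow>\<^sub>0 complex) \<times> (generator free_monoid \<Rightarrow>\<^sub>0 complex)) set"
  for n :: nat where
  s_squared: "i \<in> {1..<n} \<Longrightarrow> (gs i * gs i, 1) \<in> relations n"
| s_s_far: "\<lbrakk>i \<in> {1..<n}; j \<in> {1..<n}; \<bar>int i - int j\<bar> > 1\<rbrakk>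
    \<Longrightarrow> (gs i * gs j, gs j * gs i) \<in> relations n"
| s_e_far: "\<lbrakk>i \<in> {1..<n}; j \<in> {1..<n}; \<bar>int i - int j\<bar> > 1\<rbrakk>
    \<Longrightarrow> (gs i * ge j, ge j * gs i) \<in> relations n"
| e_e_far: "\<lbrakk>i \<in> {1..<n}; j \<in> {1..<n}; \<bar>int i - int j\<bar> > 1\<rbrakk>
    \<Longrightarrow> (ge i * ge j, ge j * ge i) \<in> relations n"
| braid: "\<lbrakk>i \<in> {1..<n}; i + 1 \<in> {1..<n}\<rbrakk>
    \<Longrightarrow> (gs i * gs (i+1) * gs i, gs (i+1) * gs i * gs (i+1)) \<in> relations n"
| y_y: "\<lbrakk>i \<in> {1..n}; j \<in> {1..n}\<rbrakk> \<Longrightarrow> (gy i * gy j, gy j * gy i) \<in> relations n"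
| e_y_far: "\<lbrakk>i \<in> {1..<n}; j \<in> {1..n}; j \<noteq> i; j \<noteq> i + 1\<rbrakk>
    \<Longrightarrow> (ge i * gy j, gy j * ge i) \<in> relations n"
| s_y_far: "\<lbrakk>i \<in> {1..<n}; j \<in> {1..n}; j \<noteq> i; j \<noteq> i + 1\<rbrakk>
    \<Longrightarrow> (gs i * gy j, gy j * gs i) \<in> relations n"
| e_e_e_up: "\<lbrakk>i \<in> {1..<n}; i + 1 \<in> {1..<n}\<rbrakk>
    \<Longrightarrow> (ge (i+1) * ge i * ge (i+1), - ge (i+1)) \<in> relations n"
| e_e_e_down: "\<lbrakk>i \<in> {1..<n}; i + 1 \<in> {1..<n}\<rbrakk>
    \<Longrightarrow> (ge i * ge (i+1) * ge i, - ge i) \<in> relations n"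
| e_s: "i \<in> {1..<n} \<Longrightarrow> (ge i * gs i, ge i) \<in> relations n"
| s_e: "i \<in> {1..<n} \<Longrightarrow> (gs i * ge i, - ge i) \<in> relations n"
| s_e_e_down: "\<lbrakk>i \<in> {1..<n}; i + 1 \<in> {1..<n}\<rbrakk>
    \<Longrightarrow> (gs i * ge (i+1) * ge i, gs (i+1) * ge i) \<in> relations n"
| s_e_e_up: "\<lbrakk>i \<in> {1..<n}; i + 1 \<in> {1..<n}\<rbrakk>
    \<Longrightarrow> (gs (i+1) * ge i * ge (i+1), - (gs i * ge (i+1))) \<in> relations n"
| e_e_s_up: "\<lbrakk>i \<in> {1..<n}; i + 1 \<in> {1..<n}\<rbrakk>
    \<Longrightarrow> (ge (i+1) * ge i * gs (i+1), ge (i+1) * gs i) \<in> relations n"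
| e_e_s_down: "\<lbrakk>i \<in> {1..<n}; i + 1 \<in> {1..<n}\<rbrakk>
    \<Longrightarrow> (ge i * ge (i+1) * gs i, - (ge i * gs (i+1))) \<in> relations n"
| e_squared: "i \<in> {1..<n} \<Longrightarrow> (ge i * ge i, 0) \<in> relations n"
| s_y: "i \<in> {1..<n} \<Longrightarrow> (gs i * gy i - gy (i+1) * gs i, - ge i - 1) \<in> relations n"
| y_s: "i \<in> {1..<n} \<Longrightarrow> (gy i * gs i - gs i * gy (i+1), ge i - 1) \<in> relations n"
| e_y: "i \<in> {1..<n} \<Longrightarrow> (ge i * (gy i - gy (i+1)), - ge i) \<in> relations n"
| y_e: "i \<in> {1..<n} \<Longrightarrow> ((gy i - gy (i+1)) * ge i, ge i) \<in> relations n"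

definition relation_ideal :: "nat \<Rightarrow> (generator free_monoid \<Rightarrow>\<^sub>0 complex) set" where
  "relation_ideal n = Idl\<^bsub>free_algebra (generators n)\<^esub> {a - b |a b. (a, b) \<in> relations n}"

definition periplectic_brauer :: "nat \<Rightarrow> (generator free_monoid \<Rightarrow>\<^sub>0 complex) set ring"
    (\<open>\<V>\<close>) where
  "\<V> n = free_algebra (generators n) Quot relation_ideal n"

definition to_V :: "nat \<Rightarrow> (generator free_monoid \<Rightarrow>\<^sub>0 complex)
    \<Rightarrow> (generator free_monoid \<Rightarrow>\<^sub>0 complex) set" where
  "to_V n f = relation_ideal n +>\<^bsub>free_algebra (generators n)\<^esub> f"

definition e_V :: "nat \<Rightarrow> nat \<Rightarrow> (generator free_monoid \<Rightarrow>\<^sub>0 complex) set" where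
  "e_V n i = to_V n (ge i)"


subsection \<open>Well-definedness\<close>

lemma free_algebra_closed:
  shows "f \<in> carrier (free_algebra A) \<Longrightarrow> g \<in> carrier (free_algebra A) \<Longrightarrow> f * g \<in> carrier (free_algebra A)"
    and "f \<in> carrier (free_algebra A) \<Longrightarrow> g \<in> carrier (free_algebra A) \<Longrightarrow> f - g \<in> carrier (free_algebra A)"
    and "f \<in> carrier (free_algebra A) \<Longrightarrow> - f \<in> carrier (free_algebra A)"
    and "1 \<in> carrier (free_algebra A)"
    and "0 \<in> carrier (free_algebra A)"
    and "x \<in> A \<Longrightarrow> free_var x \<in> carrier (free_algebra A)"
proof -
  show "f \<in> carrier (free_algebra A) \<Longrightarrow> g \<in> carrier (free_algebra A) \<Longrightarrow> f * g \<in> carrier (free_algebra A)"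
    using ring.ring_simprules(5)[OF ring_free_algebra, of f A g] by (simp add: free_algebra_def)
  show "f \<in> carrier (free_algebra A) \<Longrightarrow> g \<in> carrier (free_algebra A) \<Longrightarrow> f - g \<in> carrier (free_algebra A)"
    using keys_diff[of f g] by (auto simp: free_algebra_def)
qed (auto simp: free_algebra_def zero_free_monoid_def)

lemma relations_carrier:
  assumes "(a, b) \<in> relations n"
  shows "a \<in> carrier (free_algebra (generators n)) \<and> b \<in> carrier (free_algebra (generators n))"
  using assms
  by induction (auto intro!: free_algebra_closed simp: generators_def)

lemma ideal_relation_ideal: "ideal (relation_ideal n) (free_algebra (generators n))"
  unfolding relation_ideal_def
  by (rule ring.genideal_ideal[OF ring_free_algebra])
    (auto intro!: free_algebra_closed dest: relations_carrier)

lemma ring_V: "ring (\<V> n)"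
  unfolding periplectic_brauer_def by (rule ideal.quotient_is_ring[OF ideal_relation_ideal])

lemma to_V_ring_hom: "to_V n \<in> ring_hom (free_algebra (generators n)) (\<V> n)"
  using ideal.rcos_ring_hom[OF ideal_relation_ideal, of n]
  by (simp add: periplectic_brauer_def to_V_def[abs_def])

lemma to_V_surj: "to_V n ` carrier (free_algebra (generators n)) = carrier (\<V> n)"
  by (auto simp: periplectic_brauer_def to_V_def FactRing_def A_RCOSETS_def')

lemma to_V_relations:
  assumes "(a, b) \<in> relations n"
  shows "to_V n a = to_V n b"
proof -
  let ?F = "free_algebra (generators n)"
  interpret ideal "relation_ideal n" ?F by (rule ideal_relation_ideal)
  have ab: "a \<in> carrier ?F" "b \<in> carrier ?F"
    using relations_carrier[OF assms] by auto
  have "(a - b) \<oplus>\<^bsub>?F\<^esub> b = a"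
    by (simp add: free_algebra_def)
  moreover have "a - b \<in> relation_ideal n"
    unfolding relation_ideal_def using assms
    by (intro subsetD[OF genideal_self])
      (auto intro!: free_algebra_closed dest: relations_carrier)
  ultimately have "a \<in> relation_ideal n +>\<^bsub>?F\<^esub> b"
    by (force simp: a_r_coset_def')
  then show ?thesis
    unfolding to_V_def using ab by (metis a_repr_independence a_subgroup)
qed

lemma e_V_closed: "i \<in> {1..<n} \<Longrightarrow> e_V n i \<in> carrier (\<V> n)"
  unfolding e_V_def
  by (rule ring_hom_closed[OF to_V_ring_hom]) (auto intro!: free_algebra_closed simp: generators_def)

end

theory Submission
  imports Defs "HOL-Combinatorics.Permutations"
begin

text \<open>
  The quotient of the algebra by \<open>(e\<^sub>1)\<close> is the degenerate affine Hecke algebra. Its principal series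
  modules, realised on the orbit \<open>\<chi> \<circ> \<sigma>\<close> of a weight \<open>\<chi>\<close>, are simple for generic \<open>\<chi>\<close>, so the radical
  annihilates them. Modulo \<open>e\<^sub>1\<close> every element is a combination of normal forms, a monomial in the
  \<open>y\<^sub>j\<close> times a coset-representative word in the \<open>s\<^sub>i\<close>. When \<open>\<chi>\<close> tends to infinity, a word in the
  \<open>s\<^sub>i\<close> degenerates to the permutation it represents, and the leading term of a nonzero combination
  survives; hence no such combination annihilates all generic modules, and the radical lies in
  \<open>(e\<^sub>1)\<close>. The inclusion is strict because \<open>e\<^sub>1\<close> acts nontrivially on a simple module of dimension
  \<open>n - 1\<close>, on which the \<open>s\<^sub>i\<close> permute coordinates.
\<close>

section \<open>Modules given by generators and relations\<close>

text \<open>The radical is tested through vectors: the annihilator of a nonzero vector in a simple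
  module is a maximal left ideal. Rewriting shows only that the normal forms span modulo
  \<open>e_ideal n\<close>; their independence has to come from the same modules that test the
  radical. One principal series module is finite dimensional and cannot separate them, since a
  polynomial in the y_j may vanish on a whole orbit, so a family of weights with a parameter t is
  used. The choice \<chi>_j = t^(M^j) turns distinct monomials of degree below M into distinct
  powers of t. It also makes all differences of weights large, which gives genericity and removes
  the correction terms of the s_i in the limit. For strictness, e_i maps every vector to a multiple
  of the simple root \<epsilon>_(i+1) - \<epsilon>_i and kills that root itself. A neighbouring root
  is needed to see e_1, and this is where n > 2 enters.\<close>

lemma poly_mapping_sum_single:
  fixes f :: "'a \<Rightarrow>\<^sub>0 'b::comm_monoid_add"
  shows "f = (\<Sum>k\<in>Poly_Mapping.keys f. Poly_Mapping.single k (Poly_Mapping.lookup f k))"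
  by (rule poly_mapping_eqI)
    (simp add: lookup_sum lookup_single when_def sum.delta in_keys_iff)

lemma poly_mapping_induct_single [case_names single add]:
  fixes f :: "'a \<Rightarrow>\<^sub>0 'b::comm_monoid_add"
  assumes single: "\<And>k c. P (Poly_Mapping.single k c)"
    and add: "\<And>f g. P f \<Longrightarrow> P g \<Longrightarrow> P (f + g)"
  shows "P f"
proof -
  have "P (\<Sum>k\<in>K. Poly_Mapping.single k (Poly_Mapping.lookup f k))" if "finite K" for K
    using that
  proof (induction K)
    case empty
    \<comment> \<open>Zero is a single term with coefficient 0 at an arbitrary key.\<close>
    show ?case using single[of undefined 0] by simp
  next
    case (insert k K)
    then show ?case using single add by simp
  qed
  then show ?thesis
    using poly_mapping_sum_single[of f] by (metis finite_keys)
qed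

section \<open>Evaluating noncommutative polynomials at operators\<close>

text \<open>\<open>foldr\<close> lets the leftmost letter act last, as in a left module. Vectors are
  complex-valued functions, so linear combinations are formed pointwise.\<close>

definition act ::
    "('x \<Rightarrow> ('b \<Rightarrow> complex) \<Rightarrow> 'b \<Rightarrow> complex) \<Rightarrow> ('x free_monoid \<Rightarrow>\<^sub>0 complex) \<Rightarrow> ('b \<Rightarrow> complex) \<Rightarrow> 'b \<Rightarrow> complex"
  where "act \<rho> f v b = (\<Sum>w\<in>Poly_Mapping.keys f. Poly_Mapping.lookup f w * foldr \<rho> (letters w) v b)"

lemma act_superset:
  assumes "finite K" "Poly_Mapping.keys f \<subseteq> K"
  shows "act \<rho> f v b = (\<Sum>w\<in>K. Poly_Mapping.lookup f w * foldr \<rho> (letters w) v b)"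
  unfolding act_def using assms by (intro sum.mono_neutral_left) (auto simp: in_keys_iff)

lemma act_add: "act \<rho> (f + g) v b = act \<rho> f v b + act \<rho> g v b"
proof -
  let ?K = "Poly_Mapping.keys f \<union> Poly_Mapping.keys g"
  have "finite ?K" "Poly_Mapping.keys (f + g) \<subseteq> ?K"
    using keys_add[of f g] by auto
  then show ?thesis
    by (simp add: act_superset[of ?K] lookup_add distrib_right sum.distrib)
qed

lemma act_single: "act \<rho> (Poly_Mapping.single w c) v b = c * foldr \<rho> (letters w) v b"
  by (simp add: act_def)

lemma act_uminus: "act \<rho> (- f) v b = - act \<rho> f v b"
  by (simp add: act_def sum_negf)

lemma act_diff: "act \<rho> (f - g) v b = act \<rho> f v b - act \<rho> g v b"
  using act_add[of \<rho> f "- g"] by (simp add: act_uminus)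

lemma act_zero: "act \<rho> 0 v b = 0"
  by (simp add: act_def)

lemma act_one: "act \<rho> 1 v = v"
  by (rule ext) (simp add: act_def zero_free_monoid_def flip: single_one)

lemma act_free_var: "act \<rho> (free_var x) v = \<rho> x v"
  by (rule ext) (simp add: act_single)

locale linear_operators =
  fixes \<rho> :: "'x \<Rightarrow> ('b \<Rightarrow> complex) \<Rightarrow> 'b \<Rightarrow> complex"
  assumes linear: "\<rho> x (\<lambda>b. c * u b + d * v b) = (\<lambda>b. c * \<rho> x u b + d * \<rho> x v b)"
begin

lemma op_zero [simp]: "\<rho> x (\<lambda>b. 0) = (\<lambda>b. 0)"
  using linear[of x 0 "\<lambda>b. 0" 0 "\<lambda>b. 0"] by simp

lemma foldr_linear:
  "foldr \<rho> xs (\<lambda>b. c * u b + d * v b) = (\<lambda>b. c * foldr \<rho> xs u b + d * foldr \<rho> xs v b)"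
  by (induction xs) (simp_all add: linear)

lemma act_linear:
  "act \<rho> f (\<lambda>b. c * u b + d * v b) = (\<lambda>b. c * act \<rho> f u b + d * act \<rho> f v b)"
  by (rule ext) (simp add: act_def foldr_linear sum_distrib_left sum.distrib algebra_simps)

lemma act_zero_right [simp]: "act \<rho> f (\<lambda>b. 0) = (\<lambda>b. 0)"
  using act_linear[of f 0 "\<lambda>b. 0" 0 "\<lambda>b. 0"] by simp

lemma act_mult: "act \<rho> (f * g) v = act \<rho> f (act \<rho> g v)"
proof (induction f rule: poly_mapping_induct_single)
  case (single k c)
  show ?case
  proof (induction g rule: poly_mapping_induct_single)
    case (single l d)
    have "foldr \<rho> (letters k) (\<lambda>b. d * foldr \<rho> (letters l) v b) =
        (\<lambda>b. d * foldr \<rho> (letters k) (foldr \<rho> (letters l) v) b)"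
      using foldr_linear[of "letters k" d _ 0 v] by simp
    then show ?case
      by (intro ext) (simp add: mult_single act_single plus_free_monoid_def)
  next
    case (add f g)
    have "act \<rho> (Poly_Mapping.single k c) (\<lambda>b. act \<rho> f v b + act \<rho> g v b) =
        (\<lambda>b. act \<rho> (Poly_Mapping.single k c) (act \<rho> f v) b
           + act \<rho> (Poly_Mapping.single k c) (act \<rho> g v) b)"
      using act_linear[of _ 1 _ 1] by simp
    then show ?case
      using add by (intro ext) (simp add: distrib_left act_add)
  qed
next
  case (add f g)
  then show ?case by (intro ext) (simp add: distrib_right act_add)
qed

end

section \<open>Ideals of the free algebra and the quotient map\<close>

lemma free_algebra_simps [simp]:
  "monoid.mult (free_algebra A) = (*)" "one (free_algebra A) = 1"
  "add (free_algebra A) = (+)" "zero (free_algebra A) = 0"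
  by (simp_all add: free_algebra_def)

lemma free_algebra_carrier_add:
  "f \<in> carrier (free_algebra A) \<Longrightarrow> g \<in> carrier (free_algebra A) \<Longrightarrow> f + g \<in> carrier (free_algebra A)"
  using ring.ring_simprules(1)[OF ring_free_algebra, of f A g] by simp

lemma free_algebra_carrier_single:
  "set (letters w) \<subseteq> A \<Longrightarrow> Poly_Mapping.single w c \<in> carrier (free_algebra A)"
  by (auto simp: free_algebra_def)

lemmas free_algebra_carrier = free_algebra_closed free_algebra_carrier_add free_algebra_carrier_single

lemma free_algebra_a_inv:
  assumes "f \<in> carrier (free_algebra A)"
  shows "a_inv (free_algebra A) f = - f"
proof -
  interpret ring "free_algebra A" by (rule ring_free_algebra)
  show ?thesis
    using minus_equality[of "- f" f] assms free_algebra_closed(3)[of f A] by simp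
qed

lemma ideal_free_algebra_closed:
  assumes "ideal I (free_algebra A)"
  shows "f \<in> I \<Longrightarrow> f \<in> carrier (free_algebra A)" "0 \<in> I"
    "f \<in> I \<Longrightarrow> g \<in> I \<Longrightarrow> f + g \<in> I" "f \<in> I \<Longrightarrow> - f \<in> I" "f \<in> I \<Longrightarrow> g \<in> I \<Longrightarrow> f - g \<in> I"
    "f \<in> I \<Longrightarrow> g \<in> carrier (free_algebra A) \<Longrightarrow> g * f \<in> I"
    "f \<in> I \<Longrightarrow> g \<in> carrier (free_algebra A) \<Longrightarrow> f * g \<in> I"
proof -
  interpret ideal I "free_algebra A" by (rule assms)
  show c: "f \<in> carrier (free_algebra A)" if "f \<in> I" for f using that by (rule a_Hcarr)
  show "0 \<in> I" using additive_subgroup.zero_closed[OF additive_subgroup_axioms] by simp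
  show a: "f + g \<in> I" if "f \<in> I" "g \<in> I" for f g
    using additive_subgroup.a_closed[OF additive_subgroup_axioms] that by simp
  show m: "- f \<in> I" if "f \<in> I" for f
    using additive_subgroup.a_inv_closed[OF additive_subgroup_axioms that]
    by (simp add: free_algebra_a_inv c that)
  show "f - g \<in> I" if "f \<in> I" "g \<in> I" for f g
    using a[OF that(1) m[OF that(2)]] by simp
  show "f \<in> I \<Longrightarrow> g \<in> carrier (free_algebra A) \<Longrightarrow> g * f \<in> I"
    "f \<in> I \<Longrightarrow> g \<in> carrier (free_algebra A) \<Longrightarrow> f * g \<in> I"
    using I_l_closed I_r_closed by auto
qed

lemma ideal_free_algebraI:
  assumes sub: "I \<subseteq> carrier (free_algebra A)" and z: "0 \<in> I"
    and add: "\<And>f g. f \<in> I \<Longrightarrow> g \<in> I \<Longrightarrow> f + g \<in> I"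
    and l: "\<And>f g. f \<in> I \<Longrightarrow> g \<in> carrier (free_algebra A) \<Longrightarrow> g * f \<in> I"
    and r: "\<And>f g. f \<in> I \<Longrightarrow> g \<in> carrier (free_algebra A) \<Longrightarrow> f * g \<in> I"
  shows "ideal I (free_algebra A)"
proof (rule idealI[OF ring_free_algebra])
  interpret ring "free_algebra A" by (rule ring_free_algebra)
  show "subgroup I (add_monoid (free_algebra A))"
  proof (rule group.subgroupI)
    show "group (add_monoid (free_algebra A))" by (rule a_group)
    fix f assume f: "f \<in> I"
    then have "inv\<^bsub>add_monoid (free_algebra A)\<^esub> f = (- 1) * f"
      using free_algebra_a_inv[of f A] sub by (auto simp: a_inv_def)
    also have "\<dots> \<in> I" using f by (intro l free_algebra_closed)
    finally show "inv\<^bsub>add_monoid (free_algebra A)\<^esub> f \<in> I" .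
  qed (use sub z add in auto)
qed (use l r in auto)

lemma to_V_simps:
  assumes "f \<in> carrier (free_algebra (generators n))" "g \<in> carrier (free_algebra (generators n))"
  shows "to_V n (f + g) = to_V n f \<oplus>\<^bsub>\<V> n\<^esub> to_V n g" "to_V n (f * g) = to_V n f \<otimes>\<^bsub>\<V> n\<^esub> to_V n g"
  using ring_hom_add[OF to_V_ring_hom assms] ring_hom_mult[OF to_V_ring_hom assms] by simp_all

lemma to_V_one: "to_V n 1 = \<one>\<^bsub>\<V> n\<^esub>"
  using ring_hom_one[OF to_V_ring_hom[of n]] by simp

lemma to_V_zero: "to_V n 0 = \<zero>\<^bsub>\<V> n\<^esub>"
  using ring_hom_zero[OF to_V_ring_hom[of n] ring_free_algebra ring_V] by simp

lemma to_V_closed: "f \<in> carrier (free_algebra (generators n)) \<Longrightarrow> to_V n f \<in> carrier (\<V> n)"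
  by (rule ring_hom_closed[OF to_V_ring_hom])

lemma carrier_V_cases:
  assumes "X \<in> carrier (\<V> n)"
  obtains f where "f \<in> carrier (free_algebra (generators n))" "X = to_V n f"
  using assms unfolding to_V_surj[of n, symmetric] by blast

lemma to_V_uminus:
  assumes "f \<in> carrier (free_algebra (generators n))"
  shows "to_V n (- f) = \<ominus>\<^bsub>\<V> n\<^esub> to_V n f"
proof -
  interpret V: ring "\<V> n" by (rule ring_V)
  have "to_V n (- f) \<oplus>\<^bsub>\<V> n\<^esub> to_V n f = \<zero>\<^bsub>\<V> n\<^esub>"
    using to_V_simps(1)[of "- f" n f] assms by (simp add: free_algebra_closed to_V_zero)
  then show ?thesis
    using V.minus_equality assms by (metis free_algebra_closed(3) to_V_closed)
qed

lemma to_V_eq_iff: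
  assumes "f \<in> carrier (free_algebra (generators n))" "g \<in> carrier (free_algebra (generators n))"
  shows "to_V n f = to_V n g \<longleftrightarrow> f - g \<in> relation_ideal n"
proof -
  interpret ring "free_algebra (generators n)" by (rule ring_free_algebra)
  show ?thesis
    using quotient_eq_iff_same_a_r_cos[OF ideal_relation_ideal assms]
    by (simp add: to_V_def a_minus_def free_algebra_a_inv assms)
qed

section \<open>Cyclic submodules and maximal left ideals\<close>

text \<open>The relations are imposed only on an invariant subspace \<open>W\<close>. The principal
  series formula divides by a difference of weights that may vanish away from the orbit; in the
  other module \<open>W\<close> cuts out the simple part.\<close>

locale V_module = linear_operators \<rho> for \<rho> :: "generator \<Rightarrow> ('b \<Rightarrow> complex) \<Rightarrow> 'b \<Rightarrow> complex" +
  fixes n :: nat and W :: "('b \<Rightarrow> complex) set"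
  assumes W_zero: "(\<lambda>b. 0) \<in> W"
    and W_linear: "\<And>u v c d. u \<in> W \<Longrightarrow> v \<in> W \<Longrightarrow> (\<lambda>b. c * u b + d * v b) \<in> W"
    and W_closed: "\<And>x v. x \<in> generators n \<Longrightarrow> v \<in> W \<Longrightarrow> \<rho> x v \<in> W"
    and relations_act: "\<And>a b v. (a, b) \<in> relations n \<Longrightarrow> v \<in> W \<Longrightarrow> act \<rho> a v = act \<rho> b v"
begin

abbreviation "FA \<equiv> free_algebra (generators n)"

lemma foldr_closed: "set xs \<subseteq> generators n \<Longrightarrow> v \<in> W \<Longrightarrow> foldr \<rho> xs v \<in> W"
  by (induction xs) (auto intro: W_closed)

lemma act_closed:
  assumes "f \<in> carrier FA" "v \<in> W"
  shows "act \<rho> f v \<in> W"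
proof -
  have "(\<lambda>b. \<Sum>w\<in>K. Poly_Mapping.lookup f w * foldr \<rho> (letters w) v b) \<in> W"
    if "finite K" "K \<subseteq> Poly_Mapping.keys f" for K
    using that
  proof (induction K)
    case (insert w K)
    have "foldr \<rho> (letters w) v \<in> W"
      using insert.prems assms by (intro foldr_closed) (auto simp: free_algebra_def)
    from W_linear[OF this, of _ "Poly_Mapping.lookup f w" 1] insert show ?case by simp
  qed (simp add: W_zero)
  from this[OF finite_keys order_refl] show ?thesis
    by (simp add: act_def[abs_def])
qed

definition annihilator :: "(generator free_monoid \<Rightarrow>\<^sub>0 complex) set" where
  "annihilator = {f \<in> carrier FA. \<forall>v\<in>W. act \<rho> f v = (\<lambda>b. 0)}"

lemma ideal_annihilator: "ideal annihilator FA"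
  by (rule ideal_free_algebraI)
    (auto simp: annihilator_def act_zero act_add act_mult fun_eq_iff intro: act_closed
      intro!: free_algebra_carrier, auto simp: act_closed simp flip: fun_eq_iff)

lemma diff_relations_annihilator:
  assumes "(a, b) \<in> relations n"
  shows "a - b \<in> annihilator"
  using relations_act[OF assms] relations_carrier[OF assms]
  by (auto simp: annihilator_def act_diff fun_eq_iff intro!: free_algebra_carrier)

text \<open>This is why the action of the free algebra descends to \<open>\<V> n\<close>.\<close>

lemma relation_ideal_subset: "relation_ideal n \<subseteq> annihilator"
  unfolding relation_ideal_def
  by (rule ring.genideal_minimal[OF ring_free_algebra ideal_annihilator])
    (auto intro: diff_relations_annihilator)

lemma act_relation_ideal: "f \<in> relation_ideal n \<Longrightarrow> v \<in> W \<Longrightarrow> act \<rho> f v b = 0"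
  using relation_ideal_subset by (auto simp: annihilator_def fun_eq_iff)

text \<open>Membership of \<open>u\<close> in the cyclic submodule generated by
  \<open>v\<close>.\<close>

definition reaches :: "('b \<Rightarrow> complex) \<Rightarrow> ('b \<Rightarrow> complex) \<Rightarrow> bool" where
  "reaches v u \<longleftrightarrow> (\<exists>f\<in>carrier FA. act \<rho> f v = u)"

lemma reaches_refl: "reaches v v"
  unfolding reaches_def by (intro bexI[of _ 1]) (auto simp: act_one free_algebra_closed)

lemma reaches_trans: "reaches v u \<Longrightarrow> reaches u w \<Longrightarrow> reaches v w"
  unfolding reaches_def by (metis act_mult free_algebra_closed(1))

lemma reaches_generator: "x \<in> generators n \<Longrightarrow> reaches v (\<rho> x v)"
  unfolding reaches_def by (metis act_free_var free_algebra_closed(6))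

lemma reaches_linear:
  assumes "reaches v u" "reaches v w"
  shows "reaches v (\<lambda>b. c * u b + d * w b)"
proof -
  obtain f g where f: "f \<in> carrier FA" "act \<rho> f v = u" and g: "g \<in> carrier FA" "act \<rho> g v = w"
    using assms by (auto simp: reaches_def)
  let ?h = "Poly_Mapping.single 0 c * f + Poly_Mapping.single 0 d * g"
  have "?h \<in> carrier FA"
    using f g by (intro free_algebra_carrier) (auto simp: zero_free_monoid_def)
  moreover have "act \<rho> ?h v = (\<lambda>b. c * u b + d * w b)"
    by (intro ext) (simp add: act_add act_mult act_single zero_free_monoid_def f g)
  ultimately show ?thesis by (auto simp: reaches_def)
qed

lemma reaches_scale: "c \<noteq> 0 \<Longrightarrow> reaches v (\<lambda>b. c * u b) \<Longrightarrow> reaches v u"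
  using reaches_linear[of v "\<lambda>b. c * u b" "\<lambda>b. c * u b" "1 / c" 0] by simp

text \<open>The hypothesis makes the submodule generated by \<open>v0\<close> simple. If a larger
  left ideal contains the class of f with f v0 \<noteq> 0, some g sends f v0 back to v0, so 1 - g f
  annihilates v0 and 1 = (1 - g f) + g f lies in that ideal.\<close>

lemma maximal_left_ideal_annihilator_vector:
  assumes v0: "v0 \<in> W" "v0 \<noteq> (\<lambda>b. 0)"
    and reach: "\<And>v. v \<in> W \<Longrightarrow> v \<noteq> (\<lambda>b. 0) \<Longrightarrow> reaches v v0"
  shows "maximal_left_ideal (to_V n ` {f \<in> carrier FA. act \<rho> f v0 = (\<lambda>b. 0)}) (\<V> n)"
    (is "maximal_left_ideal (to_V n ` ?A) _")
proof -
  interpret V: ring "\<V> n" by (rule ring_V)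
  \<comment> \<open>Whether f kills \<open>v0\<close> depends only on its class, since the relation
    ideal acts by zero.\<close>
  have mem: "f \<in> ?A" if f: "f \<in> carrier FA" "to_V n f \<in> to_V n ` ?A" for f
  proof -
    obtain g where g: "g \<in> ?A" "to_V n f = to_V n g" using f(2) by blast
    then have "f - g \<in> relation_ideal n" using f to_V_eq_iff by auto
    then have "act \<rho> (f - g) v0 = (\<lambda>b. 0)" using v0 by (auto simp: act_relation_ideal)
    then show ?thesis using g f by (auto simp: act_diff fun_eq_iff)
  qed
  have li: "left_ideal (to_V n ` ?A) (\<V> n)"
  proof (intro left_ideal.intro left_ideal_axioms.intro V.ring_axioms additive_subgroup.intro)
    show "subgroup (to_V n ` ?A) (add_monoid (\<V> n))"
    proof (rule group.subgroupI[OF V.a_group])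
      show "to_V n ` ?A \<subseteq> carrier (add_monoid (\<V> n))" by (auto intro: to_V_closed)
      have "(0 :: generator free_monoid \<Rightarrow>\<^sub>0 complex) \<in> ?A" by (simp add: act_zero fun_eq_iff free_algebra_closed)
      then show "to_V n ` ?A \<noteq> {}" by blast
      fix X assume "X \<in> to_V n ` ?A"
      then obtain f where f: "f \<in> ?A" "X = to_V n f" by auto
      have "- f \<in> ?A" using f by (auto simp: act_uminus fun_eq_iff free_algebra_closed)
      moreover have "inv\<^bsub>add_monoid (\<V> n)\<^esub> X = to_V n (- f)"
        using f to_V_uminus[of f n] by (simp add: a_inv_def)
      ultimately show "inv\<^bsub>add_monoid (\<V> n)\<^esub> X \<in> to_V n ` ?A" by auto
      fix Y assume "Y \<in> to_V n ` ?A"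
      then obtain g where g: "g \<in> ?A" "Y = to_V n g" by auto
      have "f + g \<in> ?A" using f g by (auto simp: act_add fun_eq_iff free_algebra_carrier)
      moreover have "X \<otimes>\<^bsub>add_monoid (\<V> n)\<^esub> Y = to_V n (f + g)"
        using f g by (simp add: to_V_simps)
      ultimately show "X \<otimes>\<^bsub>add_monoid (\<V> n)\<^esub> Y \<in> to_V n ` ?A" by auto
    qed
    fix X Z assume "X \<in> to_V n ` ?A" "Z \<in> carrier (\<V> n)"
    then obtain f where f: "f \<in> ?A" "X = to_V n f" by blast
    obtain g where g: "g \<in> carrier FA" "Z = to_V n g"
      using \<open>Z \<in> carrier (\<V> n)\<close> by (rule carrier_V_cases)
    have "g * f \<in> ?A" using f g by (auto simp: act_mult free_algebra_closed)
    moreover have "Z \<otimes>\<^bsub>\<V> n\<^esub> X = to_V n (g * f)"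
      using f g to_V_simps(2)[of g n f] by simp
    ultimately show "Z \<otimes>\<^bsub>\<V> n\<^esub> X \<in> to_V n ` ?A" by blast
  qed
  show ?thesis
  proof (intro maximal_left_ideal.intro maximal_left_ideal_axioms.intro li)
    show "carrier (\<V> n) \<noteq> to_V n ` ?A"
    proof
      assume "carrier (\<V> n) = to_V n ` ?A"
      then have "to_V n 1 \<in> to_V n ` ?A" by (metis free_algebra_closed(4) to_V_closed)
      from mem[OF free_algebra_closed(4) this] v0 show False by (simp add: act_one)
    qed
    fix J assume J: "left_ideal J (\<V> n)" "to_V n ` ?A \<subseteq> J" "J \<subseteq> carrier (\<V> n)"
    interpret J: left_ideal J "\<V> n" by (rule J)
    show "J = to_V n ` ?A \<or> J = carrier (\<V> n)"
    proof (rule disjCI)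
      assume "J \<noteq> carrier (\<V> n)"
      show "J = to_V n ` ?A"
      proof (rule ccontr)
        assume "J \<noteq> to_V n ` ?A"
        then obtain X where X: "X \<in> J" "X \<notin> to_V n ` ?A" using J by blast
        have "X \<in> carrier (\<V> n)" using X J(3) by blast
        then obtain f where f: "f \<in> carrier FA" "X = to_V n f" by (rule carrier_V_cases)
        have "act \<rho> f v0 \<noteq> (\<lambda>b. 0)" using X f by auto
        from reach[OF act_closed[OF f(1) v0(1)] this]
        obtain g where g: "g \<in> carrier FA" "act \<rho> g (act \<rho> f v0) = v0"
          by (auto simp: reaches_def)
        have gf: "g * f \<in> carrier FA" using f g by (simp add: free_algebra_closed)
        have 1: "1 - g * f \<in> ?A"
          using f g by (auto simp: act_diff act_one act_mult intro!: free_algebra_closed)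
        have "to_V n g \<otimes>\<^bsub>\<V> n\<^esub> X \<in> J" using X g by (intro J.I_l_closed to_V_closed)
        then have 2: "to_V n (g * f) \<in> J" using f g by (simp add: to_V_simps)
        have "to_V n (1 - g * f) \<oplus>\<^bsub>\<V> n\<^esub> to_V n (g * f) \<in> J"
          using 1 2 J by (intro J.a_closed) auto
        then have "\<one>\<^bsub>\<V> n\<^esub> \<in> J"
          using to_V_simps(1)[of "1 - g * f" n "g * f"] 1 gf by (simp add: to_V_one)
        then have "x \<in> J" if "x \<in> carrier (\<V> n)" for x
          using J.I_l_closed[of "\<one>\<^bsub>\<V> n\<^esub>" x] that by simp
        then show False using \<open>J \<noteq> carrier (\<V> n)\<close> J(3) by blast
      qed
    qed
  qed
qed

lemma jacobson_radical_act:
  assumes "f \<in> carrier FA" "to_V n f \<in> jacobson_radical (\<V> n)"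
    and "v0 \<in> W" "v0 \<noteq> (\<lambda>b. 0)" "\<And>v. v \<in> W \<Longrightarrow> v \<noteq> (\<lambda>b. 0) \<Longrightarrow> reaches v v0"
  shows "act \<rho> f v0 = (\<lambda>b. 0)"
proof -
  have "to_V n f \<in> to_V n ` {f \<in> carrier FA. act \<rho> f v0 = (\<lambda>b. 0)}"
    using assms(2) maximal_left_ideal_annihilator_vector[OF assms(3-5)]
    by (auto simp: jacobson_radical_def)
  then obtain g where g: "g \<in> carrier FA" "act \<rho> g v0 = (\<lambda>b. 0)" "to_V n f = to_V n g" by auto
  then have "f - g \<in> relation_ideal n" using to_V_eq_iff assms(1) by auto
  then show ?thesis
    using act_relation_ideal[of "f - g" v0] assms(3) g by (auto simp: act_diff fun_eq_iff)
qed

end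

section \<open>A simple module on which \<open>e\<^sub>1\<close> does not vanish\<close>

definition simple_root :: "nat \<Rightarrow> nat \<Rightarrow> complex" where
  "simple_root i m = (if m = Suc i then 1 else if m = i then - 1 else 0)"

definition partial_sum :: "(nat \<Rightarrow> complex) \<Rightarrow> nat \<Rightarrow> complex" where
  "partial_sum w j = (\<Sum>k\<in>{1..<j}. w k)"

text \<open>
  Starting from \<open>y\<^sub>1 = 0\<close>, the relations force \<open>y\<^sub>j\<close> to act as the Jucys-Murphy element: the sum over
  \<open>k < j\<close> of \<open>(k j) + e\<^sub>k\<^sub>j\<close>, where \<open>e\<^sub>k\<^sub>j w = (w\<^sub>k + w\<^sub>j) (\<epsilon>\<^sub>j - \<epsilon>\<^sub>k)\<close>.
\<close>

fun std_op :: "generator \<Rightarrow> (nat \<Rightarrow> complex) \<Rightarrow> nat \<Rightarrow> complex" where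
  "std_op (S i) w m = w (transpose i (Suc i) m)"
| "std_op (E i) w m = (w i + w (Suc i)) * simple_root i m"
| "std_op (Y j) w m =
    (if m = j then (of_nat j - 1) * w j + 2 * partial_sum w j
     else if 1 \<le> m \<and> m < j then (of_nat j - 3) * w m
     else (of_nat j - 1) * w m)"

lemma partial_sum_Suc: "1 \<le> j \<Longrightarrow> partial_sum w (Suc j) = partial_sum w j + w j"
  by (simp add: partial_sum_def)

lemma partial_sum_linear:
  "partial_sum (\<lambda>b. c * u b + d * v b) j = c * partial_sum u j + d * partial_sum v j"
  by (simp add: partial_sum_def sum.distrib sum_distrib_left)

interpretation std: linear_operators std_op
proof
  fix x c d u v
  show "std_op x (\<lambda>b. c * u b + d * v b) = (\<lambda>b. c * std_op x u b + d * std_op x v b)"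
    by (cases x) (auto simp: fun_eq_iff partial_sum_linear algebra_simps)
qed

text \<open>Partial sums are the only nonlocal part of \<open>std_op (Y j)\<close>. A swap of i and
  i + 1 changes only the sum that stops between them.\<close>

lemma partial_sum_S:
  assumes "1 \<le> i"
  shows "partial_sum (std_op (S i) w) j = (if j = Suc i then partial_sum w i + w (Suc i) else partial_sum w j)"
proof (induction j)
  case (Suc j)
  consider "j < i" | "j = i" | "j = Suc i" | "Suc i < j" by linarith
  then show ?case
  proof cases
    case 1
    then show ?thesis using Suc by (cases "j = 0") (auto simp: partial_sum_Suc transpose_def, simp add: partial_sum_def)
  next
    case 2
    then show ?thesis using Suc assms by (auto simp: partial_sum_Suc transpose_def)
  next
    case 3
    then show ?thesis using Suc assms by (auto simp: partial_sum_Suc transpose_def)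
  next
    case 4
    then show ?thesis using Suc by (auto simp: partial_sum_Suc transpose_def)
  qed
qed (use assms in \<open>auto simp: partial_sum_def\<close>)

lemma partial_sum_E:
  assumes "1 \<le> i"
  shows "partial_sum (std_op (E i) w) j = (if j = Suc i then - (w i + w (Suc i)) else 0)"
proof (induction j)
  case (Suc j)
  consider "j < i" | "j = i" | "j = Suc i" | "Suc i < j" by linarith
  then show ?case
  proof cases
    case 1
    then show ?thesis using Suc by (cases "j = 0") (auto simp: partial_sum_Suc simple_root_def, simp add: partial_sum_def)
  qed (use Suc assms in \<open>auto simp: partial_sum_Suc simple_root_def\<close>)
qed (use assms in \<open>auto simp: partial_sum_def\<close>)

text \<open>For i < j the term \<open>2 * partial_sum w i\<close> at coordinate i makes up for the
  smaller factor on the coordinates below i. Each partial sum is thus an eigenfunctional of y_i, so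
  the sum-zero space is invariant.\<close>

lemma partial_sum_Y:
  assumes "1 \<le> i"
  shows "partial_sum (std_op (Y i) w) j = (if i < j then of_nat i - 1 else of_nat i - 3) * partial_sum w j"
proof (induction j)
  case (Suc j)
  consider "j < i" | "j = i" | "i < j" by linarith
  then show ?case
  proof cases
    case 1
    then show ?thesis using Suc by (cases "j = 0") (auto simp: partial_sum_Suc algebra_simps, simp add: partial_sum_def)
  qed (use Suc assms in \<open>auto simp: partial_sum_Suc algebra_simps\<close>)
qed (use assms in \<open>auto simp: partial_sum_def\<close>)

definition std_space :: "nat \<Rightarrow> (nat \<Rightarrow> complex) set" where
  "std_space n = {w. (\<forall>m. m \<notin> {1..n} \<longrightarrow> w m = 0) \<and> partial_sum w (Suc n) = 0}"

lemma partial_sum_simple_root: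
  assumes "1 \<le> i"
  shows "partial_sum (simple_root i) j = (if j = Suc i then - 1 else 0)"
proof -
  have "simple_root i = std_op (E i) (\<lambda>m. if m = i then 1 else 0)"
    by (simp add: fun_eq_iff)
  then show ?thesis using partial_sum_E[OF assms, of "\<lambda>m. if m = i then 1 else 0" j] by simp
qed

lemma std_relations:
  assumes "(a, b) \<in> relations n"
  shows "act std_op a v = act std_op b v"
proof -
  note act_simps = std.act_mult act_free_var act_one act_zero act_add act_diff act_uminus
  note sums = partial_sum_S partial_sum_E partial_sum_Suc partial_sum_simple_root
  show ?thesis
    using assms
  proof cases
    case (y_y i j)
    then have "1 \<le> i" "1 \<le> j" by auto
    note Y_sums = partial_sum_Y[OF \<open>1 \<le> i\<close>] partial_sum_Y[OF \<open>1 \<le> j\<close>]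
    \<comment> \<open>The eigenvalue in \<open>partial_sum_Y\<close> depends on which index is
      larger, hence the split by order.\<close>
    have "std_op (Y i) (std_op (Y j) v) m = std_op (Y j) (std_op (Y i) v) m" for m
    proof (cases i j rule: linorder_cases)
      case less
      then show ?thesis
        using \<open>1 \<le> i\<close> by (simp add: Y_sums) (simp add: algebra_simps)
    next
      case greater
      then show ?thesis
        using \<open>1 \<le> j\<close> by (simp add: Y_sums) (simp add: algebra_simps)
    qed simp
    then show ?thesis
      unfolding y_y act_simps fun_eq_iff by blast
  next
    case (e_y_far i j)
    then have "1 \<le> i" by auto
    show ?thesis
      unfolding e_y_far act_simps fun_eq_iff
      using e_y_far(3-) by (auto simp: sums[OF \<open>1 \<le> i\<close>] simple_root_def transpose_def algebra_simps)
  next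
    case (s_y_far i j)
    then have "1 \<le> i" by auto
    show ?thesis
      unfolding s_y_far act_simps fun_eq_iff
      using s_y_far(3-) by (auto simp: sums[OF \<open>1 \<le> i\<close>] simple_root_def transpose_def algebra_simps)
  next
    case (s_y i)
    then have "1 \<le> i" by auto
    show ?thesis
      unfolding s_y act_simps fun_eq_iff
      using s_y(3-) by (auto simp: sums[OF \<open>1 \<le> i\<close>] simple_root_def transpose_def algebra_simps)
  next
    case (y_s i)
    then have "1 \<le> i" by auto
    show ?thesis
      unfolding y_s act_simps fun_eq_iff
      using y_s(3-) by (auto simp: sums[OF \<open>1 \<le> i\<close>] simple_root_def transpose_def algebra_simps)
  next
    case (e_y i)
    then have "1 \<le> i" by auto
    show ?thesis
      unfolding e_y act_simps fun_eq_iff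
      using e_y(3-) by (auto simp: sums[OF \<open>1 \<le> i\<close>] simple_root_def transpose_def algebra_simps)
  next
    case (y_e i)
    then have "1 \<le> i" by auto
    show ?thesis
      unfolding y_e act_simps fun_eq_iff
      using y_e(3-) by (auto simp: sums[OF \<open>1 \<le> i\<close>] simple_root_def transpose_def algebra_simps)
  qed (auto simp: act_simps fun_eq_iff sums simple_root_def transpose_def)
qed

lemma V_module_std: "V_module std_op n (std_space n)"
proof
  fix x v assume x: "x \<in> generators n" and v: "v \<in> std_space n"
  show "std_op x v \<in> std_space n"
  proof (cases x)
    case (S i)
    then show ?thesis using x v partial_sum_S[of i v "Suc n"]
      by (auto simp: std_space_def generators_def transpose_def)
  next
    case (E i)
    then show ?thesis using x v partial_sum_E[of i v "Suc n"]
      by (auto simp: std_space_def generators_def simple_root_def)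
  next
    case (Y i)
    then show ?thesis using x v partial_sum_Y[of i v "Suc n"]
      by (auto simp: std_space_def generators_def)
  qed
qed (auto simp: std_space_def partial_sum_linear std_relations, simp add: partial_sum_def)

text \<open>On a vector whose coordinates i and i + 1 differ, s_i - 1 yields a multiple of the i-th
  simple root. Then e_i lowers root i + 1 to minus root i, down to root 1, and e_2 raises root 1 to
  root 2, on which e_1 acts nontrivially.\<close>

lemma std_reaches_simple_root:
  assumes "v \<in> std_space n" "v \<noteq> (\<lambda>b. 0)" "n > 2"
  shows "V_module.reaches std_op n v (simple_root 2)"
proof -
  interpret V_module std_op n "std_space n" by (rule V_module_std)
  \<comment> \<open>A constant vector with coordinate sum zero would be zero.\<close>
  have "\<exists>i\<in>{1..<n}. v i \<noteq> v (Suc i)"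
  proof (rule ccontr)
    assume "\<not> ?thesis"
    then have c: "v (Suc i) = v i" if "1 \<le> i" "i < n" for i
      using that by (metis atLeastLessThan_iff)
    have eq: "v m = v 1" if "1 \<le> m" "m \<le> n" for m
      using that by (induction m rule: dec_induct) (simp_all add: c)
    have "partial_sum v (Suc n) = (\<Sum>k\<in>{1..<Suc n}. v 1)"
      unfolding partial_sum_def by (intro sum.cong refl eq) simp_all
    then have "v 1 = 0" using assms by (auto simp: std_space_def)
    have "v m = 0" for m
      using eq[of m] \<open>v 1 = 0\<close> assms(1) by (cases "m \<in> {1..n}") (auto simp: std_space_def)
    then show False using assms(2) by auto
  qed
  then obtain i where i: "1 \<le> i" "i < n" "v i \<noteq> v (Suc i)" by auto
  have "reaches v (\<lambda>b. 1 * std_op (S i) v b + (- 1) * v b)"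
    using i by (intro reaches_linear reaches_refl reaches_generator) (auto simp: generators_def)
  also have "(\<lambda>b. 1 * std_op (S i) v b + (- 1) * v b) = (\<lambda>b. (v i - v (Suc i)) * simple_root i b)"
    by (auto simp: fun_eq_iff simple_root_def transpose_def)
  finally have vi: "reaches v (simple_root i)"
    using i reaches_scale[of "v i - v (Suc i)"] by simp
  have i1: "reaches (simple_root i) (simple_root 1)" if "1 \<le> i" "i < n" for i
    using that
  proof (induction i rule: dec_induct)
    case base
    show ?case by (rule reaches_refl)
  next
    case (step i)
    have "reaches (simple_root (Suc i)) (std_op (E i) (simple_root (Suc i)))"
      using step by (intro reaches_generator) (auto simp: generators_def)
    also have "std_op (E i) (simple_root (Suc i)) = (\<lambda>b. (- 1) * simple_root i b)"
      by (auto simp: fun_eq_iff simple_root_def)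
    finally have "reaches (simple_root (Suc i)) (simple_root i)"
      using reaches_scale[of "- 1"] by simp
    then show ?case using step by (auto intro: reaches_trans)
  qed
  have "reaches (simple_root 1) (std_op (E 2) (simple_root 1))"
    using assms by (intro reaches_generator) (auto simp: generators_def)
  also have "std_op (E 2) (simple_root 1) = simple_root 2"
    by (auto simp: fun_eq_iff simple_root_def)
  finally show ?thesis using vi i1[OF i(1,2)] by (blast intro: reaches_trans)
qed

lemma e_V_not_in_jacobson_radical:
  assumes "n > 2"
  shows "e_V n 1 \<notin> jacobson_radical (\<V> n)"
proof
  interpret V_module std_op n "std_space n" by (rule V_module_std)
  assume "e_V n 1 \<in> jacobson_radical (\<V> n)"
  then have "act std_op (ge 1) (simple_root 2) = (\<lambda>b. 0)"
    using assms unfolding e_V_def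
    by (intro jacobson_radical_act std_reaches_simple_root free_algebra_closed)
      (auto simp: generators_def std_space_def partial_sum_simple_root simple_root_def fun_eq_iff)
  \<comment> \<open>The image is minus the first simple root, whose coordinate 1 is in fact
    1.\<close>
  then have "std_op (E 1) (simple_root 2) 1 = 0" by (simp only: act_free_var)
  then show False by (simp add: simple_root_def)
qed

section \<open>Principal series modules\<close>

text \<open>The symmetric group on n letters, generated by the moves that \<open>ps_op\<close>
  makes, so that proofs can follow paths from the identity.\<close>

inductive_set word_perms :: "nat \<Rightarrow> (nat \<Rightarrow> nat) set" for n where
  id: "id \<in> word_perms n"
| step: "\<sigma> \<in> word_perms n \<Longrightarrow> i \<in> {1..<n} \<Longrightarrow> \<sigma> \<circ> transpose i (Suc i) \<in> word_perms n"

lemma word_perms_permutes: "\<sigma> \<in> word_perms n \<Longrightarrow> \<sigma> permutes {1..n}"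
proof (induction rule: word_perms.induct)
  case (step \<sigma> i)
  then show ?case by (intro permutes_compose permutes_swap_id) auto
qed (rule permutes_id)

lemma finite_word_perms: "finite (word_perms n)"
  by (rule finite_subset[OF _ finite_permutations[of "{1..n}"]]) (blast intro: word_perms_permutes, simp)

lemma comp_transpose_cancel [simp]: "\<sigma> \<circ> transpose a b \<circ> transpose a b = \<sigma>"
  by (simp add: o_assoc[symmetric])

lemma word_perms_step_iff:
  assumes "i \<in> {1..<n}"
  shows "\<sigma> \<circ> transpose i (Suc i) \<in> word_perms n \<longleftrightarrow> \<sigma> \<in> word_perms n"
  using word_perms.step[of _ n i] assms by (metis comp_transpose_cancel)

text \<open>
  A function \<open>F\<close> stands for the function \<open>\<chi> \<circ> \<sigma> \<mapsto> F \<sigma>\<close> on weights; \<open>s\<^sub>i\<close> acts as the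
  Demazure-Lusztig operator. The formula is meaningful only if \<open>\<chi> (\<sigma> i) \<noteq> \<chi> (\<sigma> (i + 1))\<close>.
\<close>

fun ps_op :: "(nat \<Rightarrow> complex) \<Rightarrow> generator \<Rightarrow> ((nat \<Rightarrow> nat) \<Rightarrow> complex) \<Rightarrow> (nat \<Rightarrow> nat) \<Rightarrow> complex" where
  "ps_op \<chi> (S i) F \<sigma> = F (\<sigma> \<circ> transpose i (Suc i)) +
     (F (\<sigma> \<circ> transpose i (Suc i)) - F \<sigma>) / (\<chi> (\<sigma> i) - \<chi> (\<sigma> (Suc i)))"
| "ps_op \<chi> (E i) F \<sigma> = 0"
| "ps_op \<chi> (Y j) F \<sigma> = \<chi> (\<sigma> j) * F \<sigma>"

interpretation ps: linear_operators "ps_op \<chi>" for \<chi>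
proof
  fix x c d u v
  show "ps_op \<chi> x (\<lambda>b. c * u b + d * v b) = (\<lambda>b. c * ps_op \<chi> x u b + d * ps_op \<chi> x v b)"
    by (cases x) (auto simp: fun_eq_iff divide_inverse algebra_simps)
qed

definition ps_space :: "nat \<Rightarrow> ((nat \<Rightarrow> nat) \<Rightarrow> complex) set" where
  "ps_space n = {F. \<forall>\<sigma>. \<sigma> \<notin> word_perms n \<longrightarrow> F \<sigma> = 0}"

lemma ps_space_closed: "x \<in> generators n \<Longrightarrow> F \<in> ps_space n \<Longrightarrow> ps_op \<chi> x F \<in> ps_space n"
  by (cases x) (auto simp: ps_space_def generators_def word_perms_step_iff)

lemma ps_space_zero: "F \<in> ps_space n \<Longrightarrow> \<sigma> \<notin> word_perms n \<Longrightarrow> F \<sigma> = 0"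
  by (simp add: ps_space_def)

lemma comp_transpose_far:
  assumes "i \<noteq> j" "Suc i \<noteq> j" "i \<noteq> Suc j"
  shows "\<sigma> \<circ> transpose i (Suc i) \<circ> transpose j (Suc j) = \<sigma> \<circ> transpose j (Suc j) \<circ> transpose i (Suc i)"
  using assms by (auto simp: fun_eq_iff transpose_def)

lemma comp_transpose_braid:
  "\<sigma> \<circ> transpose i (Suc i) \<circ> transpose (Suc i) (Suc (Suc i)) \<circ> transpose i (Suc i) =
   \<sigma> \<circ> transpose (Suc i) (Suc (Suc i)) \<circ> transpose i (Suc i) \<circ> transpose (Suc i) (Suc (Suc i))"
  by (auto simp: fun_eq_iff transpose_def)

section \<open>The Hecke relations for Demazure-Lusztig operators\<close>

text \<open>The operator of s_i with the inverse difference of weights as a free variable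
  \<open>x\<close>: identities become polynomial, and the default value of division stays out of
  them.\<close>

definition demazure :: "complex \<Rightarrow> complex \<Rightarrow> complex \<Rightarrow> complex" where
  "demazure x u v = u + (u - v) * x"

text \<open>The hypothesis holds for \<open>x = 1 / p\<close>, \<open>y = 1 / q\<close>, \<open>z = 1 / (p + q)\<close>.\<close>

lemma demazure_braid:
  assumes "x * y = z * (x + y)"
  shows "demazure x (demazure z (demazure y g d) (demazure (- x) a b)) (demazure y (demazure z e c) (demazure x b a)) =
    demazure y (demazure z (demazure x g e) (demazure (- y) a c)) (demazure x (demazure z d b) (demazure y c a))"
    (is "?l = ?r")
proof -
  have "?l - ?r = (x * y - z * (x + y)) * ((y - x) * a + (1 + x) * b - (1 + y) * c)"
    unfolding demazure_def by (simp add: algebra_simps)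
  then show ?thesis using assms by simp
qed

text \<open>The two cross relations between s_i and the y with e_i = 0. The weight at position i is
  a at \<sigma> and b at its reflection, and the discrepancy is a - b times its own inverse.\<close>

lemma demazure_commutator:
  assumes "a \<noteq> b"
  shows "demazure (inverse (a - b)) (b * u) (a * v) - b * demazure (inverse (a - b)) u v = - v"
    and "a * demazure (inverse (a - b)) u v - demazure (inverse (a - b)) (a * u) (b * v) = - v"
proof -
  have "demazure p (b * u) (a * v) - b * demazure p u v = - ((a - b) * p) * v"
    "a * demazure p u v - demazure p (a * u) (b * v) = - ((a - b) * p) * v" for p
    by (simp_all add: demazure_def algebra_simps)
  then show "demazure (inverse (a - b)) (b * u) (a * v) - b * demazure (inverse (a - b)) u v = - v"
    and "a * demazure (inverse (a - b)) u v - demazure (inverse (a - b)) (a * u) (b * v) = - v"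
    using assms by simp_all
qed

lemma ps_op_S:
  "ps_op \<chi> (S i) F \<sigma> =
    demazure (inverse (\<chi> (\<sigma> i) - \<chi> (\<sigma> (Suc i)))) (F (\<sigma> \<circ> transpose i (Suc i))) (F \<sigma>)"
  by (simp add: demazure_def divide_inverse)

lemma ps_S_squared: "ps_op \<chi> (S i) (ps_op \<chi> (S i) F) \<sigma> = F \<sigma>"
proof -
  define d where "d = \<chi> (\<sigma> i) - \<chi> (\<sigma> (Suc i))"
  have d: "\<chi> (\<sigma> i) - \<chi> (\<sigma> (Suc i)) = d" "\<chi> (\<sigma> (Suc i)) - \<chi> (\<sigma> i) = - d"
    by (auto simp: d_def)
  show ?thesis
    unfolding ps_op_S
    by (simp only: o_apply transpose_apply_first transpose_apply_second d
        comp_transpose_cancel inverse_minus_eq demazure_def) (simp add: algebra_simps)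
qed

text \<open>The orbit of \<sigma> under the two adjacent transpositions has six points, and the
  values of \<open>F\<close> there are the variables of \<open>demazure_braid\<close>. Up to sign
  the differences of weights are p, q and p + q.\<close>

lemma ps_S_braid:
  assumes "\<chi> (\<sigma> i) \<noteq> \<chi> (\<sigma> (Suc i))" "\<chi> (\<sigma> (Suc i)) \<noteq> \<chi> (\<sigma> (Suc (Suc i)))"
    "\<chi> (\<sigma> i) \<noteq> \<chi> (\<sigma> (Suc (Suc i)))"
  shows "ps_op \<chi> (S i) (ps_op \<chi> (S (Suc i)) (ps_op \<chi> (S i) F)) \<sigma> =
    ps_op \<chi> (S (Suc i)) (ps_op \<chi> (S i) (ps_op \<chi> (S (Suc i)) F)) \<sigma>"
proof -
  define p where "p = \<chi> (\<sigma> i) - \<chi> (\<sigma> (Suc i))"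
  define q where "q = \<chi> (\<sigma> (Suc i)) - \<chi> (\<sigma> (Suc (Suc i)))"
  define x y z where "x = inverse p" and "y = inverse q" and "z = inverse (p + q)"
  have "p \<noteq> 0" "q \<noteq> 0" "p + q \<noteq> 0"
    using assms by (auto simp: p_def q_def)
  then have xyz: "x * y = z * (x + y)"
    by (simp add: x_def y_def z_def field_simps)
  have pq: "\<chi> (\<sigma> i) - \<chi> (\<sigma> (Suc i)) = p" "\<chi> (\<sigma> (Suc i)) - \<chi> (\<sigma> i) = - p"
    "\<chi> (\<sigma> (Suc i)) - \<chi> (\<sigma> (Suc (Suc i))) = q" "\<chi> (\<sigma> (Suc (Suc i))) - \<chi> (\<sigma> (Suc i)) = - q"
    "\<chi> (\<sigma> i) - \<chi> (\<sigma> (Suc (Suc i))) = p + q" "\<chi> (\<sigma> (Suc (Suc i))) - \<chi> (\<sigma> i) = - (p + q)"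
    by (auto simp: p_def q_def)
  have t: "transpose i (Suc i) (Suc (Suc i)) = Suc (Suc i)" "transpose (Suc i) (Suc (Suc i)) i = i"
    by (auto simp: transpose_def)
  show ?thesis
    unfolding ps_op_S
    by (simp only: o_apply transpose_apply_first transpose_apply_second t pq
        comp_transpose_cancel inverse_minus_eq flip: x_def y_def z_def)
      (simp only: comp_transpose_braid demazure_braid[OF xyz])
qed

text \<open>Off the orbit, functions in \<open>ps_space n\<close> and their images vanish, so both
  sides are zero. On it, \<sigma> permutes the positions and injectivity of \<chi> keeps every
  denominator nonzero.\<close>

lemma V_module_ps:
  assumes inj: "inj_on \<chi> {1..n}"
  shows "V_module (ps_op \<chi>) n (ps_space n)"
proof
  fix a b F assume ab: "(a, b) \<in> relations n" and F: "F \<in> ps_space n"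
  note act_simps = ps.act_mult act_free_var act_one act_zero act_add act_diff act_uminus
  show "act (ps_op \<chi>) a F = act (ps_op \<chi>) b F"
  proof (rule ext)
    fix \<sigma>
    show "act (ps_op \<chi>) a F \<sigma> = act (ps_op \<chi>) b F \<sigma>"
    proof (cases "\<sigma> \<in> word_perms n")
      case False
      have S: "ps_op \<chi> (S i) G \<sigma> = 0" "ps_op \<chi> (S i) G \<in> ps_space n"
        if "G \<in> ps_space n" "i \<in> {1..<n}" for G i
      proof -
        have "S i \<in> generators n" using that by (auto simp: generators_def)
        from ps_space_closed[OF this that(1)] show "ps_op \<chi> (S i) G \<in> ps_space n" .
        then show "ps_op \<chi> (S i) G \<sigma> = 0" by (rule ps_space_zero[OF _ False])
      qed
      have EY: "ps_op \<chi> (E i) G \<in> ps_space n" "ps_op \<chi> (Y j) G \<in> ps_space n"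
        if "G \<in> ps_space n" for G i j
        using that by (auto simp: ps_space_def)
      have E0: "ps_op \<chi> (E i) G \<rho> = 0" for G i \<rho> by simp
      have EY': "ps_op \<chi> (Y j) G \<sigma> = 0" if "G \<in> ps_space n" for G j
        using that False by (auto simp: ps_space_def)
      show ?thesis
        using ab
        by cases (simp_all add: act_simps S E0 EY EY' F ps_space_zero[OF F False] del: ps_op.simps)
    next
      case True
      have perm: "\<sigma> permutes {1..n}" using True by (rule word_perms_permutes)
      have neq: "\<chi> (\<sigma> i) \<noteq> \<chi> (\<sigma> j)" if "i \<in> {1..n}" "j \<in> {1..n}" "i \<noteq> j" for i j
        using inj perm that permutes_in_image[OF perm] inj_onD[OF inj, of "\<sigma> i" "\<sigma> j"]
          injD[OF permutes_inj[OF perm], of i j] by blast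
      show ?thesis
        using ab
      proof cases
        case (s_squared i)
        then show ?thesis by (simp add: act_simps ps_S_squared del: ps_op.simps)
      next
        case (braid i)
        then show ?thesis
          using neq[of i "Suc i"] neq[of "Suc i" "Suc (Suc i)"] neq[of i "Suc (Suc i)"] ps_S_braid[of \<chi> \<sigma> i F]
          by (simp add: act_simps del: ps_op.simps)
      next
        case (s_s_far i j)
        then have far: "i \<noteq> j" "Suc i \<noteq> j" "i \<noteq> Suc j" by auto
        then have t: "transpose i (Suc i) j = j" "transpose i (Suc i) (Suc j) = Suc j"
            "transpose j (Suc j) i = i" "transpose j (Suc j) (Suc i) = Suc i"
          by (auto simp: transpose_def)
        define p where "p = inverse (\<chi> (\<sigma> i) - \<chi> (\<sigma> (Suc i)))"
        define q where "q = inverse (\<chi> (\<sigma> j) - \<chi> (\<sigma> (Suc j)))"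
        show ?thesis
          unfolding s_s_far act_simps ps_op.simps
          by (simp add: t comp_transpose_far[OF far] divide_inverse flip: p_def q_def)
            (simp add: algebra_simps)
      next
        case (s_y_far i j)
        then have "transpose i (Suc i) j = j" by (auto simp: transpose_def)
        then show ?thesis
          unfolding s_y_far act_simps ps_op.simps by (simp add: divide_inverse algebra_simps)
      next
        case (s_y i)
        have "\<chi> (\<sigma> i) \<noteq> \<chi> (\<sigma> (Suc i))" using neq[of i "Suc i"] s_y by auto
        from demazure_commutator(1)[OF this]
        show ?thesis
          unfolding s_y act_simps ps_op_S by (simp add: act_simps)
      next
        case (y_s i)
        have "\<chi> (\<sigma> i) \<noteq> \<chi> (\<sigma> (Suc i))" using neq[of i "Suc i"] y_s by auto
        from demazure_commutator(2)[OF this]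
        show ?thesis
          unfolding y_s act_simps ps_op_S by (simp add: act_simps)
      qed (simp_all add: act_simps)
    qed
  qed
qed (auto simp: ps_space_closed, auto simp: ps_space_def)

section \<open>Simplicity for generic weights\<close>

text \<open>Distinct values let the y_j separate the points of the orbit. Differences d \<noteq> 1
  keep the coefficient 1 - 1/d nonzero, with which s_i moves a point mass to its neighbour.\<close>

definition generic :: "nat \<Rightarrow> (nat \<Rightarrow> complex) \<Rightarrow> bool" where
  "generic n \<chi> \<longleftrightarrow> (\<forall>i\<in>{1..n}. \<forall>j\<in>{1..n}. i \<noteq> j \<longrightarrow> \<chi> i \<noteq> \<chi> j \<and> \<chi> i \<noteq> \<chi> j + 1)"

definition point_mass :: "'a \<Rightarrow> 'a \<Rightarrow> complex" where
  "point_mass \<sigma> \<rho> = (if \<rho> = \<sigma> then 1 else 0)"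

context
  fixes n :: nat and \<chi> :: "nat \<Rightarrow> complex"
  assumes generic: "generic n \<chi>"
begin

lemma generic_inj: "inj_on \<chi> {1..n}"
  using generic by (auto simp: generic_def inj_on_def)

interpretation V_module "ps_op \<chi>" n "ps_space n"
  by (rule V_module_ps[OF generic_inj])

lemma point_mass_in_ps_space: "\<sigma> \<in> word_perms n \<Longrightarrow> point_mass \<sigma> \<in> ps_space n"
  by (auto simp: ps_space_def point_mass_def)

text \<open>Point masses are joint eigenvectors of the y_j with distinct eigenvalue tuples. If
  \<sigma> and \<sigma>' lie in the support and differ at j, then y_j - \<chi>(\<sigma> j) removes
  \<sigma> from the support and keeps \<sigma>'.\<close>

lemma ps_reaches_some_point_mass:
  assumes "F \<in> ps_space n" "F \<noteq> (\<lambda>\<sigma>. 0)"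
  shows "\<exists>\<sigma>\<in>word_perms n. reaches F (point_mass \<sigma>)"
  using assms
proof (induction "card {\<sigma>. F \<sigma> \<noteq> 0}" arbitrary: F rule: less_induct)
  case less
  have sub: "{\<sigma>. F \<sigma> \<noteq> 0} \<subseteq> word_perms n" using less.prems by (auto simp: ps_space_def)
  then have fin: "finite {\<sigma>. F \<sigma> \<noteq> 0}" using finite_word_perms finite_subset by blast
  obtain \<sigma> where \<sigma>: "F \<sigma> \<noteq> 0" using less.prems by auto
  show ?case
  proof (cases "\<exists>\<sigma>'. \<sigma>' \<noteq> \<sigma> \<and> F \<sigma>' \<noteq> 0")
    case False
    then have "F = (\<lambda>\<rho>. F \<sigma> * point_mass \<sigma> \<rho>)" by (intro ext) (auto simp: point_mass_def)
    then have "reaches F (point_mass \<sigma>)" using reaches_scale[OF \<sigma>] reaches_refl by metis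
    then show ?thesis using sub \<sigma> by auto
  next
    case True
    then obtain \<sigma>' where \<sigma>': "\<sigma>' \<noteq> \<sigma>" "F \<sigma>' \<noteq> 0" by auto
    have perms: "\<sigma> permutes {1..n}" "\<sigma>' permutes {1..n}"
      using sub \<sigma> \<sigma>' by (blast intro: word_perms_permutes)+
    obtain j where "\<sigma>' j \<noteq> \<sigma> j" using \<sigma>' by auto
    then have j: "j \<in> {1..n}" using perms by (metis permutes_not_in)
    have ne: "\<chi> (\<sigma>' j) \<noteq> \<chi> (\<sigma> j)"
      using \<open>\<sigma>' j \<noteq> \<sigma> j\<close> inj_onD[OF generic_inj] permutes_in_image perms j by metis
    define G where "G = (\<lambda>\<rho>. 1 * ps_op \<chi> (Y j) F \<rho> + (- \<chi> (\<sigma> j)) * F \<rho>)"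
    have G: "G \<rho> = (\<chi> (\<rho> j) - \<chi> (\<sigma> j)) * F \<rho>" for \<rho>
      by (simp add: G_def algebra_simps)
    have "reaches F G"
      unfolding G_def using j by (intro reaches_linear reaches_refl reaches_generator) (auto simp: generators_def)
    moreover have "{\<rho>. G \<rho> \<noteq> 0} \<subset> {\<rho>. F \<rho> \<noteq> 0}"
      using \<sigma> by (auto simp: G)
    then have "card {\<rho>. G \<rho> \<noteq> 0} < card {\<rho>. F \<rho> \<noteq> 0}"
      using fin by (rule psubset_card_mono[rotated])
    moreover have "G \<in> ps_space n" using less.prems by (auto simp: ps_space_def G)
    moreover have "G \<sigma>' \<noteq> 0" using ne \<sigma>' by (simp add: G)
    then have "G \<noteq> (\<lambda>\<sigma>. 0)" by auto
    ultimately show ?thesis using less.hyps[of G] reaches_trans by blast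
  qed
qed

text \<open>s_i sends the point mass at \<sigma> to -1/d times itself plus 1 - 1/d times the mass at
  the neighbour. Adding 1/d times the original isolates the neighbour.\<close>

lemma ps_reaches_step:
  assumes "\<sigma> \<in> word_perms n" "i \<in> {1..<n}"
  shows "reaches (point_mass \<sigma>) (point_mass (\<sigma> \<circ> transpose i (Suc i)))"
proof -
  let ?t = "transpose i (Suc i)"
  define d where "d = \<chi> (\<sigma> i) - \<chi> (\<sigma> (Suc i))"
  have perm: "\<sigma> permutes {1..n}" using assms(1) by (rule word_perms_permutes)
  have "\<sigma> i \<in> {1..n}" "\<sigma> (Suc i) \<in> {1..n}" "\<sigma> i \<noteq> \<sigma> (Suc i)"
    using assms permutes_in_image[OF perm] injD[OF permutes_inj[OF perm], of i "Suc i"] by auto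
  then have d: "d \<noteq> 0" "d \<noteq> 1"
    using generic by (auto simp: generic_def d_def algebra_simps)
  have "(\<sigma> \<circ> ?t) i \<noteq> \<sigma> i"
    using \<open>\<sigma> i \<noteq> \<sigma> (Suc i)\<close> by simp
  then have ne: "\<sigma> \<circ> ?t \<noteq> \<sigma>" by metis
  have ne': "\<rho> \<circ> ?t = \<sigma> \<longleftrightarrow> \<rho> = \<sigma> \<circ> ?t" for \<rho>
    by (metis comp_transpose_cancel)
  have "reaches (point_mass \<sigma>) (\<lambda>\<rho>. 1 * ps_op \<chi> (S i) (point_mass \<sigma>) \<rho> + (1 / d) * point_mass \<sigma> \<rho>)"
    using assms by (intro reaches_linear reaches_refl reaches_generator) (auto simp: generators_def)
  also have "(\<lambda>\<rho>. 1 * ps_op \<chi> (S i) (point_mass \<sigma>) \<rho> + (1 / d) * point_mass \<sigma> \<rho>)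
      = (\<lambda>\<rho>. (1 - 1 / d) * point_mass (\<sigma> \<circ> ?t) \<rho>)" (is "?l = ?r")
  proof (rule ext)
    fix \<rho>
    have dd: "\<chi> (\<sigma> (Suc i)) - \<chi> (\<sigma> i) = - d" by (simp add: d_def)
    consider "\<rho> = \<sigma>" | "\<rho> = \<sigma> \<circ> ?t" | "\<rho> \<noteq> \<sigma>" "\<rho> \<noteq> \<sigma> \<circ> ?t" by blast
    then show "?l \<rho> = ?r \<rho>"
    proof cases
      case 1
      then show ?thesis using d ne ne' by (simp add: point_mass_def flip: d_def)
    next
      case 2
      then show ?thesis using d ne ne' by (simp add: point_mass_def dd)
    next
      case 3
      then show ?thesis using d ne ne' by (simp add: point_mass_def)
    qed
  qed
  finally show ?thesis
    using reaches_scale[of "1 - 1 / d"] d by simp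
qed

lemma ps_reaches_point_mass:
  assumes "F \<in> ps_space n" "F \<noteq> (\<lambda>\<sigma>. 0)" "\<tau> \<in> word_perms n"
  shows "reaches F (point_mass \<tau>)"
proof -
  obtain \<sigma> where \<sigma>: "\<sigma> \<in> word_perms n" "reaches F (point_mass \<sigma>)"
    using ps_reaches_some_point_mass assms by blast
  \<comment> \<open>All point masses are joined through the identity; a step can be retraced because
    a transposition is an involution.\<close>
  have "reaches (point_mass \<sigma>) (point_mass id)"
    using \<sigma>(1)
  proof induction
    case (step \<sigma> i)
    from ps_reaches_step[OF word_perms.step[OF step(1,2)] step(2)] step.IH
    show ?case by (simp only: comp_transpose_cancel) (rule reaches_trans)
  qed (rule reaches_refl)
  moreover have "reaches (point_mass id) (point_mass \<tau>)"
    using assms(3)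
  proof induction
    case (step \<sigma> i)
    from ps_reaches_step[OF step(1,2)] step.IH show ?case by (rule reaches_trans[rotated])
  qed (rule reaches_refl)
  ultimately show ?thesis using \<sigma> by (blast intro: reaches_trans)
qed

lemma jacobson_radical_ps:
  assumes "f \<in> carrier FA" "to_V n f \<in> jacobson_radical (\<V> n)" "\<tau> \<in> word_perms n"
  shows "act (ps_op \<chi>) f (point_mass \<tau>) = (\<lambda>\<sigma>. 0)"
  using assms(1,2) point_mass_in_ps_space[OF assms(3)]
proof (rule jacobson_radical_act)
  show "point_mass \<tau> \<noteq> (\<lambda>\<sigma>. 0)" by (auto simp: fun_eq_iff point_mass_def)
qed (use ps_reaches_point_mass assms(3) in blast)

lemma ge_in_ps_annihilator: "i \<in> {1..<n} \<Longrightarrow> ge i \<in> annihilator"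
  by (auto simp: annihilator_def act_free_var fun_eq_iff generators_def intro!: free_algebra_closed)

end

section \<open>Normal forms modulo \<open>e\<^sub>1\<close>\<close>

text \<open>
  \<open>s\<^sub>k s\<^sub>k\<^sub>+\<^sub>1 \<dots> s\<^sub>m\<close> for \<open>1 \<le> k \<le> m + 1\<close> represent the left cosets of the symmetric group on
  \<open>m\<close> letters in the one on \<open>m + 1\<close> letters.
\<close>

fun nf_words :: "nat \<Rightarrow> nat list set" where
  "nf_words 0 = {[]}"
| "nf_words (Suc m) = {[k..<Suc m] @ w |k w. 1 \<le> k \<and> k \<le> Suc m \<and> w \<in> nf_words m}"

lemma nf_words_SucI: "1 \<le> k \<Longrightarrow> k \<le> Suc m \<Longrightarrow> w \<in> nf_words m \<Longrightarrow> [k..<Suc m] @ w \<in> nf_words (Suc m)"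
  by auto

lemma set_nf_words: "w \<in> nf_words m \<Longrightarrow> set w \<subseteq> {1..<m}"
  by (induction m arbitrary: w) fastforce+

lemma Nil_in_nf_words: "[] \<in> nf_words m"
proof (induction m)
  case (Suc m)
  then show ?case using nf_words_SucI[of "Suc m" m "[]"] by simp
qed simp

text \<open>The PBW basis of the degenerate affine Hecke algebra; sorting \<open>js\<close> selects
  one word for each commutative monomial.\<close>

definition nf_basis :: "nat \<Rightarrow> generator free_monoid set" where
  "nf_basis n = {Word (map Y js @ map S w) |js w. sorted js \<and> set js \<subseteq> {1..n} \<and> w \<in> nf_words n}"

lemma nf_basisI:
  "sorted js \<Longrightarrow> set js \<subseteq> {1..n} \<Longrightarrow> w \<in> nf_words n \<Longrightarrow> Word (map Y js @ map S w) \<in> nf_basis n"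
  by (auto simp: nf_basis_def)

definition word_monomial :: "'x list \<Rightarrow> 'x free_monoid \<Rightarrow>\<^sub>0 complex" where
  "word_monomial xs = Poly_Mapping.single (Word xs) 1"

lemma word_monomial_append: "word_monomial (u @ v) = word_monomial u * word_monomial v"
  by (simp add: word_monomial_def mult_single plus_free_monoid_def)

lemma word_monomial_Nil: "word_monomial [] = 1"
  by (simp add: word_monomial_def flip: zero_free_monoid_def)

lemma word_monomial_Cons: "word_monomial (x # v) = free_var x * word_monomial v"
  by (simp add: word_monomial_def mult_single plus_free_monoid_def)

lemma free_var_single: "free_var x * Poly_Mapping.single (Word v) c = Poly_Mapping.single (Word (x # v)) c"
  by (simp add: mult_single plus_free_monoid_def)

lemma generators_iff [simp]:
  "S i \<in> generators n \<longleftrightarrow> 1 \<le> i \<and> i < n" "E i \<in> generators n \<longleftrightarrow> 1 \<le> i \<and> i < n"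
  "Y j \<in> generators n \<longleftrightarrow> 1 \<le> j \<and> j \<le> n"
  by (auto simp: generators_def)

text \<open>Modulo \<open>K\<close> at least the relations of the degenerate affine Hecke algebra
  hold. Congruences between polynomials replace computation in a second quotient.\<close>

locale hecke_ideal =
  fixes n :: nat and K :: "(generator free_monoid \<Rightarrow>\<^sub>0 complex) set"
  assumes ideal_K: "ideal K (free_algebra (generators n))"
    and relations_K: "\<And>a b. (a, b) \<in> relations n \<Longrightarrow> a - b \<in> K"
    and ge_K: "\<And>i. i \<in> {1..<n} \<Longrightarrow> ge i \<in> K"
begin

abbreviation "FA \<equiv> free_algebra (generators n)"

lemmas K_closed = ideal_free_algebra_closed[OF ideal_K]

lemma word_monomial_carrier: "set u \<subseteq> generators n \<Longrightarrow> word_monomial u \<in> carrier FA"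
  unfolding word_monomial_def by (rule free_algebra_carrier_single) simp

section \<open>Rewriting single words modulo \<open>K\<close>\<close>

definition wcong :: "generator list \<Rightarrow> generator list \<Rightarrow> bool" where
  "wcong u v \<longleftrightarrow> word_monomial u - word_monomial v \<in> K"

lemma wcong_refl: "wcong u u"
  by (simp add: wcong_def K_closed)

lemma wcong_sym: "wcong u v \<Longrightarrow> wcong v u"
  unfolding wcong_def using K_closed(4)[of "word_monomial u - word_monomial v"] by simp

lemma wcong_trans [trans]: "wcong u v \<Longrightarrow> wcong v w \<Longrightarrow> wcong u w"
  unfolding wcong_def using K_closed(3)[of "word_monomial u - word_monomial v" "word_monomial v - word_monomial w"] by simp

lemma wcong_context:
  assumes "wcong u v" "set a \<subseteq> generators n" "set b \<subseteq> generators n"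
  shows "wcong (a @ u @ b) (a @ v @ b)"
proof -
  have "word_monomial a * (word_monomial u - word_monomial v) * word_monomial b \<in> K"
    using assms by (intro K_closed(7)[OF K_closed(6)] word_monomial_carrier) (auto simp: wcong_def)
  then show ?thesis by (simp add: wcong_def word_monomial_append algebra_simps)
qed

lemma wcong_Cons: "wcong u v \<Longrightarrow> x \<in> generators n \<Longrightarrow> wcong (x # u) (x # v)"
  using wcong_context[of u v "[x]" "[]"] by simp

lemma wcong_single:
  assumes "wcong u v"
  shows "Poly_Mapping.single (Word u) c - Poly_Mapping.single (Word v) c \<in> K"
proof -
  have "Poly_Mapping.single 0 c * (word_monomial u - word_monomial v) \<in> K"
    using assms by (intro K_closed(6) free_algebra_carrier) (auto simp: wcong_def zero_free_monoid_def)
  then show ?thesis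
    by (simp add: word_monomial_def right_diff_distrib mult_single)
qed

lemma wcong_relation: "(word_monomial u, word_monomial v) \<in> relations n \<Longrightarrow> wcong u v"
  unfolding wcong_def by (rule relations_K)

lemma wcong_S_squared: "i \<in> {1..<n} \<Longrightarrow> wcong [S i, S i] []"
  by (rule wcong_relation) (auto simp: word_monomial_Cons word_monomial_Nil intro: s_squared)

lemma wcong_S_far: "i \<in> {1..<n} \<Longrightarrow> j \<in> {1..<n} \<Longrightarrow> \<bar>int i - int j\<bar> > 1 \<Longrightarrow> wcong [S i, S j] [S j, S i]"
  by (rule wcong_relation) (auto simp: word_monomial_Cons word_monomial_Nil intro: s_s_far)

lemma wcong_braid:
  "i \<in> {1..<n} \<Longrightarrow> Suc i \<in> {1..<n} \<Longrightarrow> wcong [S i, S (Suc i), S i] [S (Suc i), S i, S (Suc i)]"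
  using braid[of i n] by (intro wcong_relation) (auto simp: word_monomial_Cons word_monomial_Nil mult.assoc)

lemma wcong_Y_Y: "i \<in> {1..n} \<Longrightarrow> j \<in> {1..n} \<Longrightarrow> wcong [Y i, Y j] [Y j, Y i]"
  by (rule wcong_relation) (auto simp: word_monomial_Cons word_monomial_Nil intro: y_y)

lemma wcong_S_slide:
  assumes "i \<in> {1..<n}" "set u \<subseteq> {1..<n}" "\<forall>j\<in>set u. \<bar>int i - int j\<bar> > 1"
  shows "wcong (S i # map S u) (map S u @ [S i])"
  using assms(2,3)
proof (induction u)
  case (Cons j u)
  have "wcong ([] @ [S i, S j] @ map S u) ([] @ [S j, S i] @ map S u)"
    using assms(1) Cons.prems by (intro wcong_context wcong_S_far) auto
  also have "wcong ([] @ [S j, S i] @ map S u) (S j # map S u @ [S i])"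
    using Cons by (auto intro: wcong_Cons)
  finally show ?case by simp
qed (simp add: wcong_refl)

lemma wcong_insort:
  assumes "j \<in> {1..n}" "set js \<subseteq> {1..n}"
  shows "wcong (Y j # map Y js) (map Y (insort j js))"
  using assms(2)
proof (induction js)
  case (Cons k js)
  have "wcong ([] @ [Y j, Y k] @ map Y js) ([] @ [Y k, Y j] @ map Y js)"
    using assms(1) Cons.prems by (intro wcong_context wcong_Y_Y) auto
  also have "wcong ([] @ [Y k, Y j] @ map Y js) (Y k # map Y (insort j js))"
    using Cons by (auto intro: wcong_Cons)
  finally show ?case by (auto simp: wcong_refl)
qed (simp add: wcong_refl)

text \<open>s_i slides past s_k, ..., s_(i-2), the braid relation turns s_i s_(i-1) s_i into s_(i-1)
  s_i s_(i-1), and the last s_(i-1) slides past s_(i+1), ..., s_m.\<close>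

lemma wcong_S_coset_rep:
  assumes "Suc m \<le> n" "1 \<le> k" "k < i" "i \<le> m"
  shows "wcong (S i # map S [k..<Suc m]) (map S [k..<Suc m] @ [S (i - 1)])"
proof -
  define a where "a = [k..<i - 1]"
  define b where "b = [Suc i..<Suc m]"
  have "[k..<Suc m] = [k..<i - 1] @ [i - 1..<Suc m]"
    using assms upt_add_eq_append[of k "i - 1" "Suc m - (i - 1)"] by simp
  also have "[i - 1..<Suc m] = (i - 1) # i # b"
    using assms upt_conv_Cons[of "i - 1" "Suc m"] upt_conv_Cons[of i "Suc m"] by (simp add: b_def del: upt_Suc)
  finally have decomp: "[k..<Suc m] = a @ [i - 1, i] @ b" by (simp add: a_def)
  have i: "i \<in> {1..<n}" "i - 1 \<in> {1..<n}" using assms by auto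
  have a: "set a \<subseteq> {1..<n}" "set b \<subseteq> {1..<n}" using assms by (auto simp: a_def b_def)
  have gen: "set (map S a) \<subseteq> generators n" "set (map S b) \<subseteq> generators n"
    "{S i, S (i - 1)} \<subseteq> generators n"
    using a i by auto
  have "wcong ([] @ (S i # map S a) @ map S ([i - 1, i] @ b)) ([] @ (map S a @ [S i]) @ map S ([i - 1, i] @ b))"
    using gen i a by (intro wcong_context wcong_S_slide) (auto simp: a_def)
  also have "wcong ([] @ (map S a @ [S i]) @ map S ([i - 1, i] @ b)) (map S a @ [S (i - 1), S i, S (i - 1)] @ map S b)"
    using gen wcong_context[OF wcong_sym[OF wcong_braid[of "i - 1"]], of "map S a" "map S b"] i by simp
  also have "wcong (map S a @ [S (i - 1), S i, S (i - 1)] @ map S b)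
      ((map S a @ [S (i - 1), S i]) @ (map S b @ [S (i - 1)]) @ [])"
  proof -
    have "wcong ((map S a @ [S (i - 1), S i]) @ (S (i - 1) # map S b) @ [])
      ((map S a @ [S (i - 1), S i]) @ (map S b @ [S (i - 1)]) @ [])"
      using gen i a by (intro wcong_context wcong_S_slide) (auto simp: b_def)
    then show ?thesis by simp
  qed
  finally show ?thesis by (simp add: decomp del: upt_Suc)
qed

text \<open>Left multiplication of the representative s_k ... s_m by s_i prolongs it (i = k - 1),
  shortens it (i = k), or passes through it as s_i (i < k - 1) or s_(i-1) (i > k). A letter that
  passes through has index below m and meets the shorter word.\<close>

lemma nf_words_S:
  assumes "m \<le> n" "w \<in> nf_words m" "i \<in> {1..<m}"
  shows "\<exists>w'\<in>nf_words m. wcong (S i # map S w) (map S w')"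
  using assms
proof (induction m arbitrary: w i)
  case (Suc m)
  then obtain k w0 where w: "w = [k..<Suc m] @ w0" and k: "1 \<le> k" "k \<le> Suc m" and w0: "w0 \<in> nf_words m"
    by auto
  have gen: "set (map S w0) \<subseteq> generators n" "set (map S [k..<Suc m]) \<subseteq> generators n"
    using set_nf_words[OF w0] k Suc.prems by auto
  have recurse: "\<exists>w'\<in>nf_words (Suc m). wcong (S i # map S w) (map S w')"
    if slide: "wcong (S i # map S [k..<Suc m]) (map S [k..<Suc m] @ [S i'])" and i': "i' \<in> {1..<m}" for i'
  proof -
    obtain w' where w': "w' \<in> nf_words m" "wcong (S i' # map S w0) (map S w')"
      using Suc.IH[OF _ w0 i'] Suc.prems by auto
    have "wcong ([] @ (S i # map S [k..<Suc m]) @ map S w0) ([] @ (map S [k..<Suc m] @ [S i']) @ map S w0)"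
      using gen by (intro wcong_context slide) auto
    also have "wcong ([] @ (map S [k..<Suc m] @ [S i']) @ map S w0) (map S [k..<Suc m] @ map S w' @ [])"
      using wcong_context[OF w'(2) gen(2), of "[]"] by simp
    finally have "wcong (S i # map S w) (map S ([k..<Suc m] @ w'))" by (simp add: w del: upt_Suc)
    then show ?thesis using nf_words_SucI[OF k w'(1)] by blast
  qed
  consider "Suc i < k" | "Suc i = k" | "i = k" | "k < i" by linarith
  then show ?case
  proof cases
    case 1
    then show ?thesis
      using Suc.prems k by (intro recurse[of i] wcong_S_slide) auto
  next
    case 2
    then have "S i # map S w = map S ([i..<Suc m] @ w0)"
      using Suc.prems k by (simp add: w upt_conv_Cons del: upt_Suc)
    then show ?thesis
      using nf_words_SucI[of i m w0] w0 Suc.prems by (intro bexI[of _ "[i..<Suc m] @ w0"]) (auto simp: wcong_refl)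
  next
    case 3
    have "S i # map S w = [] @ [S i, S i] @ map S ([Suc i..<Suc m] @ w0)"
      using 3 Suc.prems k by (simp add: w upt_conv_Cons del: upt_Suc)
    moreover have "wcong ([] @ [S i, S i] @ map S ([Suc i..<Suc m] @ w0)) ([] @ [] @ map S ([Suc i..<Suc m] @ w0))"
      using Suc.prems gen k by (intro wcong_context wcong_S_squared) auto
    ultimately show ?thesis
      using nf_words_SucI[of "Suc i" m w0] w0 Suc.prems
      by (intro bexI[of _ "[Suc i..<Suc m] @ w0"]) (auto simp del: upt_Suc)
  next
    case 4
    then show ?thesis
      using Suc.prems k by (intro recurse[of "i - 1"] wcong_S_coset_rep) auto
  qed
qed auto

section \<open>Reducing polynomials to normal forms\<close>

definition reducible :: "(generator free_monoid \<Rightarrow>\<^sub>0 complex) \<Rightarrow> bool" where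
  "reducible f \<longleftrightarrow> (\<exists>g. Poly_Mapping.keys g \<subseteq> nf_basis n \<and> f - g \<in> K)"

lemma reducible_K: "f \<in> K \<Longrightarrow> reducible f"
  unfolding reducible_def by (intro exI[of _ 0]) auto

lemma reducible_cong:
  assumes "f - f' \<in> K" "reducible f'"
  shows "reducible f"
proof -
  obtain g where g: "Poly_Mapping.keys g \<subseteq> nf_basis n" "f' - g \<in> K" using assms by (auto simp: reducible_def)
  have "f - g \<in> K" using K_closed(3)[OF assms(1) g(2)] by simp
  then show ?thesis using g by (auto simp: reducible_def)
qed

lemma reducible_add:
  assumes "reducible f" "reducible f'"
  shows "reducible (f + f')"
proof -
  obtain g g' where g: "Poly_Mapping.keys g \<subseteq> nf_basis n" "f - g \<in> K"
    "Poly_Mapping.keys g' \<subseteq> nf_basis n" "f' - g' \<in> K"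
    using assms by (auto simp: reducible_def)
  have "(f + f') - (g + g') \<in> K" using K_closed(3)[OF g(2,4)] by (simp add: algebra_simps)
  then show ?thesis using g keys_add[of g g'] unfolding reducible_def by blast
qed

lemma reducible_uminus: "reducible f \<Longrightarrow> reducible (- f)"
  unfolding reducible_def by (metis K_closed(4) keys_minus minus_diff_minus)

lemma reducible_sum: "(\<And>x. x \<in> A \<Longrightarrow> reducible (f x)) \<Longrightarrow> reducible (sum f A)"
  by (induction A rule: infinite_finite_induct) (auto intro: reducible_add reducible_K K_closed)

lemma reducible_basis: "w \<in> nf_basis n \<Longrightarrow> reducible (Poly_Mapping.single w c)"
  unfolding reducible_def by (intro exI[of _ "Poly_Mapping.single w c"]) (auto simp: K_closed)

lemma reducible_mult:
  assumes "h \<in> carrier FA" "\<And>w c. w \<in> nf_basis n \<Longrightarrow> reducible (h * Poly_Mapping.single w c)" "reducible f"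
  shows "reducible (h * f)"
proof -
  obtain g where g: "Poly_Mapping.keys g \<subseteq> nf_basis n" "f - g \<in> K" using assms by (auto simp: reducible_def)
  have "h * f - h * g \<in> K"
    using K_closed(6)[OF g(2) assms(1)] by (simp add: right_diff_distrib)
  moreover have "h * g = (\<Sum>w\<in>Poly_Mapping.keys g. h * Poly_Mapping.single w (Poly_Mapping.lookup g w))"
    by (subst poly_mapping_sum_single) (rule sum_distrib_left)
  then have "reducible (h * g)"
    using g by (auto intro!: reducible_sum assms(2))
  ultimately show ?thesis by (rule reducible_cong)
qed

lemma reducible_Y:
  assumes "j \<in> {1..n}" "reducible f"
  shows "reducible (gy j * f)"
proof (rule reducible_mult[OF _ _ assms(2)])
  show "gy j \<in> carrier FA" using assms by (intro free_algebra_closed) auto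
  fix w :: "generator free_monoid" and c
  assume "w \<in> nf_basis n"
  then obtain js u where w: "w = Word (map Y js @ map S u)" "sorted js" "set js \<subseteq> {1..n}" "u \<in> nf_words n"
    by (auto simp: nf_basis_def)
  have "wcong ([] @ (Y j # map Y js) @ map S u) ([] @ map Y (insort j js) @ map S u)"
    using assms w set_nf_words[OF w(4)] by (intro wcong_context wcong_insort) auto
  from wcong_single[OF this, of c]
  have "gy j * Poly_Mapping.single w c - Poly_Mapping.single (Word (map Y (insort j js) @ map S u)) c \<in> K"
    by (simp add: w free_var_single)
  moreover have "Word (map Y (insort j js) @ map S u) \<in> nf_basis n"
    using w assms by (intro nf_basisI) (auto simp: sorted_insort set_insort_key)
  ultimately show "reducible (gy j * Poly_Mapping.single w c)"
    by (blast intro: reducible_cong reducible_basis)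
qed

text \<open>Moving s_i past a y may leave the shorter word itself as a correction, so its
  reducibility is carried along in the induction. The list \<open>js\<close> need not be sorted,
  because \<open>reducible_Y\<close> inserts each letter in order.\<close>

lemma reducible_S_word:
  assumes i: "i \<in> {1..<n}" and u: "u \<in> nf_words n" and "set js \<subseteq> {1..n}"
  shows "reducible (Poly_Mapping.single (Word (map Y js @ map S u)) c)
    \<and> reducible (gs i * Poly_Mapping.single (Word (map Y js @ map S u)) c)"
  using assms(3)
proof (induction js)
  case Nil
  obtain u' where u': "u' \<in> nf_words n" "wcong (S i # map S u) (map S u')"
    using nf_words_S[OF order_refl u i] by auto
  have "Word (map S v) \<in> nf_basis n" if "v \<in> nf_words n" for v
    using that nf_basisI[of "[]" n v] by simp
  then show ?case
    using wcong_single[OF u'(2), of c] u u'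
    by (auto simp: free_var_single intro: reducible_basis reducible_cong)
next
  case (Cons j js)
  let ?f = "Poly_Mapping.single (Word (map Y js @ map S u)) c"
  have f: "?f \<in> carrier FA"
    using Cons.prems set_nf_words[OF u] by (intro free_algebra_carrier_single) auto
  have IH: "reducible ?f" "reducible (gs i * ?f)" and j: "j \<in> {1..n}" using Cons by auto
  have eq: "Poly_Mapping.single (Word (map Y (j # js) @ map S u)) c = gy j * ?f"
    by (simp add: free_var_single)
  have "reducible (gs i * (gy j * ?f))"
  proof -
    consider "j = i" | "j = Suc i" | "j \<noteq> i" "j \<noteq> Suc i" by blast
    then show ?thesis
    proof cases
      case 1
      \<comment> \<open>s_i y_i = y_(i+1) s_i - e_i - 1, with the e_i term absorbed by
        \<open>K\<close>.\<close>
      have "(gs i * gy i - gy (i+1) * gs i - (- ge i - 1)) * ?f - ge i * ?f \<in> K"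
        using i f by (intro K_closed(5)[OF K_closed(7) K_closed(7)] relations_K s_y ge_K)
      then have "gs i * (gy j * ?f) - (gy (i+1) * (gs i * ?f) + - ?f) \<in> K"
        by (simp add: 1 algebra_simps)
      then show ?thesis
        by (rule reducible_cong) (intro reducible_add reducible_uminus reducible_Y IH, use i in auto)
    next
      case 2
      \<comment> \<open>s_i y_(i+1) = y_i s_i - e_i + 1, again with e_i in \<open>K\<close>.\<close>
      have "- ((gy i * gs i - gs i * gy (i+1) - (ge i - 1)) * ?f + ge i * ?f) \<in> K"
        using i f by (intro K_closed(4)[OF K_closed(3)[OF K_closed(7) K_closed(7)]] relations_K y_s ge_K)
      then have "gs i * (gy j * ?f) - (gy i * (gs i * ?f) + ?f) \<in> K"
        by (simp add: 2 algebra_simps)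
      then show ?thesis
        by (rule reducible_cong) (intro reducible_add reducible_Y IH, use i in auto)
    next
      case 3
      have "(gs i * gy j - gy j * gs i) * ?f \<in> K"
        using i j f 3 by (intro K_closed(7) relations_K s_y_far) auto
      then have "gs i * (gy j * ?f) - gy j * (gs i * ?f) \<in> K"
        by (simp add: algebra_simps)
      then show ?thesis
        by (rule reducible_cong) (intro reducible_Y IH j)
    qed
  qed
  then show ?case unfolding eq using reducible_Y[OF j IH(1)] by blast
qed

lemma reducible_S:
  assumes "i \<in> {1..<n}" "reducible f"
  shows "reducible (gs i * f)"
proof (rule reducible_mult[OF _ _ assms(2)])
  show "gs i \<in> carrier FA" using assms by (intro free_algebra_closed) auto
qed (use reducible_S_word[OF assms(1)] in \<open>auto simp: nf_basis_def\<close>)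

lemma reducible_word: "set xs \<subseteq> generators n \<Longrightarrow> reducible (Poly_Mapping.single (Word xs) c)"
proof (induction xs)
  case Nil
  have "Word [] \<in> nf_basis n"
    using nf_basisI[of "[]" n "[]"] by (simp add: Nil_in_nf_words)
  then show ?case by (rule reducible_basis)
next
  case (Cons x xs)
  have "reducible (free_var x * Poly_Mapping.single (Word xs) c)"
  proof (cases x)
    case (E i)
    then have "ge i * Poly_Mapping.single (Word xs) c \<in> K"
      using Cons.prems by (intro K_closed(7) ge_K free_algebra_carrier_single) auto
    then show ?thesis using E by (auto intro: reducible_K)
  qed (use Cons in \<open>auto intro!: reducible_S reducible_Y\<close>)
  then show ?case by (simp add: free_var_single)
qed

lemma reducible_carrier:
  assumes "f \<in> carrier FA"
  shows "reducible f"
proof -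
  have "reducible (\<Sum>w\<in>Poly_Mapping.keys f. Poly_Mapping.single w (Poly_Mapping.lookup f w))"
  proof (rule reducible_sum)
    fix w assume "w \<in> Poly_Mapping.keys f"
    then show "reducible (Poly_Mapping.single w (Poly_Mapping.lookup f w))"
      using assms reducible_word[of "letters w"] by (auto simp: free_algebra_def)
  qed
  then show ?thesis by (simp flip: poly_mapping_sum_single)
qed

end

section \<open>Asymptotics of the principal series\<close>

fun word_perm :: "nat list \<Rightarrow> nat \<Rightarrow> nat" where
  "word_perm [] = id"
| "word_perm (i # w) = transpose i (Suc i) \<circ> word_perm w"

lemma word_perm_append: "word_perm (u @ v) = word_perm u \<circ> word_perm v"
  by (induction u) (simp_all add: o_assoc)

lemma inj_word_perm: "inj (word_perm w)"
proof (induction w)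
  case (Cons i w)
  then show ?case unfolding word_perm.simps by (intro inj_compose) auto
qed simp

lemma comp_word_perm_in_word_perms:
  "\<sigma> \<in> word_perms n \<Longrightarrow> set w \<subseteq> {1..<n} \<Longrightarrow> \<sigma> \<circ> word_perm w \<in> word_perms n"
proof (induction w arbitrary: \<sigma>)
  case (Cons i w)
  have "\<sigma> \<circ> transpose i (Suc i) \<in> word_perms n"
    using Cons.prems by (intro word_perms.step) auto
  from Cons.IH[OF this] Cons.prems show ?case by (simp add: o_assoc)
qed simp

lemma word_perm_fixes: "set w \<subseteq> {1..<m} \<Longrightarrow> m < j \<Longrightarrow> word_perm w j = j"
  by (induction w) (auto simp: transpose_def)

lemma word_perm_upt: "k \<le> m \<Longrightarrow> word_perm [k..<m] m = k"
proof (induction k rule: inc_induct)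
  case (step k)
  then show ?case by (simp add: upt_conv_Cons)
qed simp

text \<open>The image of m + 1 recovers k: the shorter word fixes m + 1, and s_k ... s_m sends it to
  k. After cancelling this factor the induction hypothesis applies.\<close>

lemma inj_on_word_perm: "inj_on word_perm (nf_words m)"
proof (induction m)
  case (Suc m)
  show ?case
  proof (rule inj_onI)
    fix u v assume "u \<in> nf_words (Suc m)" "v \<in> nf_words (Suc m)" and eq: "word_perm u = word_perm v"
    then obtain k l u' v' where u: "u = [k..<Suc m] @ u'" "k \<le> Suc m" "u' \<in> nf_words m"
      and v: "v = [l..<Suc m] @ v'" "l \<le> Suc m" "v' \<in> nf_words m"
      by auto
    have "word_perm u (Suc m) = k" "word_perm v (Suc m) = l"
      using u v word_perm_fixes[OF set_nf_words, of _ m "Suc m"]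
      by (simp_all add: word_perm_append word_perm_upt del: upt_Suc)
    then have "k = l" using eq by simp
    then have "word_perm [k..<Suc m] \<circ> word_perm u' = word_perm [k..<Suc m] \<circ> word_perm v'"
      using eq by (simp add: u v word_perm_append del: upt_Suc)
    then have "word_perm u' = word_perm v'"
      using inj_word_perm[of "[k..<Suc m]"] by (simp add: fun_eq_iff inj_eq)
    then show "u = v" using Suc.IH u v \<open>k = l\<close> by (auto simp: inj_on_def)
  qed
qed simp

text \<open>
  With these exponents, monomials in the weights of degree less than \<open>M\<close> are told apart by their order
  of growth in \<open>t\<close>, which reads off the degrees as digits in base \<open>M\<close>.
\<close>

definition growing_weight :: "nat \<Rightarrow> nat \<Rightarrow> nat \<Rightarrow> complex" where
  "growing_weight M t j = of_nat t ^ (M ^ j)"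

section \<open>Weights growing at different rates\<close>

text \<open>t^(M^j) is at least t times t^(M^i), and t^(M^i) is at least t.\<close>

lemma power_power_gap:
  fixes t M :: nat
  assumes "i < j" "2 \<le> M" "2 \<le> t"
  shows "t ^ (M ^ i) + (t - 1) * t \<le> t ^ (M ^ j)"
proof -
  have "M ^ i < M ^ j" using assms by simp
  from Suc_leI[OF this] have "t ^ Suc (M ^ i) \<le> t ^ (M ^ j)"
    by (rule power_increasing) (use assms in simp)
  moreover have "t ^ 1 \<le> t ^ (M ^ i)" using assms by (intro power_increasing) auto
  then have "(t - 1) * t \<le> (t - 1) * t ^ (M ^ i)" by (intro mult_le_mono2) simp
  moreover have "t ^ Suc (M ^ i) = t ^ (M ^ i) + (t - 1) * t ^ (M ^ i)"
    using assms by (cases t) auto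
  ultimately show ?thesis by linarith
qed

lemma growing_weight_gap:
  assumes "i \<noteq> j" "2 \<le> M" "2 \<le> t"
  shows "real t \<le> norm (growing_weight M t i - growing_weight M t j)"
proof -
  have *: "real t \<le> norm (growing_weight M t j - growing_weight M t i)" if "i < j" for i j
  proof -
    have "t \<le> (t - 1) * t" using assms by (cases t) auto
    with power_power_gap[OF that assms(2,3)] have "t + t ^ (M ^ i) \<le> t ^ (M ^ j)" by linarith
    then have "real t + real t ^ (M ^ i) \<le> real t ^ (M ^ j)"
      by (metis of_nat_add of_nat_le_iff of_nat_power)
    moreover have "growing_weight M t j - growing_weight M t i = of_real (real t ^ (M ^ j) - real t ^ (M ^ i))"
      by (simp add: growing_weight_def)
    then have "norm (growing_weight M t j - growing_weight M t i) = \<bar>real t ^ (M ^ j) - real t ^ (M ^ i)\<bar>"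
      by (metis norm_of_real)
    ultimately show ?thesis by linarith
  qed
  show ?thesis
    using *[of i j] *[of j i] assms(1) by (metis linorder_neqE_nat norm_minus_commute)
qed

text \<open>Weights at distinct positions are at least 3 apart, so they neither coincide nor differ
  by 1.\<close>

lemma generic_growing_weight:
  assumes "2 \<le> M" "3 \<le> t"
  shows "generic n (growing_weight M t)"
  unfolding generic_def
proof (intro ballI impI)
  fix i j :: nat assume "i \<noteq> j"
  then have g: "3 \<le> norm (growing_weight M t i - growing_weight M t j)"
    using growing_weight_gap[of i j M t] assms by linarith
  then show "growing_weight M t i \<noteq> growing_weight M t j \<and> growing_weight M t i \<noteq> growing_weight M t j + 1"
    by auto
qed

lemma tendsto_inverse_growing_weight:
  assumes "i \<noteq> j" "2 \<le> M"
  shows "(\<lambda>t. inverse (growing_weight M t i - growing_weight M t j)) \<longlonglongrightarrow> 0"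
proof (rule tendsto_0_le[where K = 1])
  show "\<forall>\<^sub>F t in sequentially.
      norm (inverse (growing_weight M t i - growing_weight M t j)) \<le> norm (inverse (real t)) * 1"
    using eventually_ge_at_top[of 2]
  proof eventually_elim
    case (elim t)
    then show ?case
      using growing_weight_gap[OF assms, of t] by (simp add: norm_inverse le_imp_inverse_le)
  qed
  show "(\<lambda>t. inverse (real t)) \<longlonglongrightarrow> 0" by (rule lim_inverse_n)
qed

text \<open>The correction term of s_i is divided by a difference of weights that tends to infinity,
  which leaves the shift by the transposition. Injectivity of \<sigma> keeps the two positions
  distinct and is inherited by the shifted permutation.\<close>

lemma tendsto_ps_word:
  assumes "inj \<sigma>" "2 \<le> M"
  shows "(\<lambda>t. foldr (ps_op (growing_weight M t)) (map S w) F \<sigma>) \<longlonglongrightarrow> F (\<sigma> \<circ> word_perm w)"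
  using assms(1)
proof (induction w arbitrary: \<sigma>)
  case (Cons i w)
  let ?t = "transpose i (Suc i)"
  let ?G = "\<lambda>t. foldr (ps_op (growing_weight M t)) (map S w) F"
  have inj: "inj (\<sigma> \<circ> ?t)" using Cons.prems by (intro inj_compose) auto
  have "\<sigma> i \<noteq> \<sigma> (Suc i)" using injD[OF Cons.prems, of i "Suc i"] by auto
  note z = tendsto_inverse_growing_weight[OF this assms(2)]
  have "(\<lambda>t. ?G t (\<sigma> \<circ> ?t) + (?G t (\<sigma> \<circ> ?t) - ?G t \<sigma>) *
      inverse (growing_weight M t (\<sigma> i) - growing_weight M t (\<sigma> (Suc i)))) \<longlonglongrightarrow>
    F (\<sigma> \<circ> ?t \<circ> word_perm w) + (F (\<sigma> \<circ> ?t \<circ> word_perm w) - F (\<sigma> \<circ> word_perm w)) * 0"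
    by (intro tendsto_intros Cons.IH inj Cons.prems z)
  moreover have "foldr (ps_op (growing_weight M t)) (map S (i # w)) F \<sigma> =
      ?G t (\<sigma> \<circ> ?t) + (?G t (\<sigma> \<circ> ?t) - ?G t \<sigma>) *
      inverse (growing_weight M t (\<sigma> i) - growing_weight M t (\<sigma> (Suc i)))" for t
    by (simp add: divide_inverse)
  moreover have "\<sigma> \<circ> word_perm (i # w) = \<sigma> \<circ> ?t \<circ> word_perm w"
    by (simp only: word_perm.simps o_assoc)
  ultimately show ?case by (simp only: mult_zero_right add_0_right)
qed simp

section \<open>Monomials and their exponents in t\<close>

lemma ps_Y_word:
  "foldr (ps_op \<chi>) (map Y js @ ws) F \<sigma> = prod_list (map (\<lambda>j. \<chi> (\<sigma> j)) js) * foldr (ps_op \<chi>) ws F \<sigma>"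
  by (induction js) simp_all

definition weight_exponent :: "nat \<Rightarrow> nat list \<Rightarrow> nat" where
  "weight_exponent M js = (\<Sum>j\<leftarrow>js. M ^ j)"

lemma prod_list_growing_weight:
  "prod_list (map (growing_weight M t) js) = of_nat t ^ weight_exponent M js"
  by (induction js) (simp_all add: weight_exponent_def growing_weight_def power_add)

lemma digits_unique:
  fixes c d :: "nat \<Rightarrow> nat"
  assumes "\<And>j. c j < M" "\<And>j. d j < M" "(\<Sum>j<N. c j * M ^ j) = (\<Sum>j<N. d j * M ^ j)" "j < N"
  shows "c j = d j"
  using assms
proof (induction N arbitrary: c d j)
  case (Suc N)
  have split: "(\<Sum>j<Suc N. c j * M ^ j) = c 0 + M * (\<Sum>j<N. c (Suc j) * M ^ j)" for c :: "nat \<Rightarrow> nat"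
    by (simp add: sum.lessThan_Suc_shift sum_distrib_left mult_ac del: sum.lessThan_Suc)
  have eq: "c 0 + M * (\<Sum>j<N. c (Suc j) * M ^ j) = d 0 + M * (\<Sum>j<N. d (Suc j) * M ^ j)"
    using Suc.prems(3) unfolding split .
  then have "(c 0 + M * (\<Sum>j<N. c (Suc j) * M ^ j)) mod M = (d 0 + M * (\<Sum>j<N. d (Suc j) * M ^ j)) mod M"
    by simp
  then have 0: "c 0 = d 0" using Suc.prems(1,2) by simp
  have "M > 0" using Suc.prems(1)[of 0] by simp
  then have s: "(\<Sum>j<N. c (Suc j) * M ^ j) = (\<Sum>j<N. d (Suc j) * M ^ j)" using eq 0 by simp
  show ?case
  proof (cases j)
    case (Suc i)
    then show ?thesis using Suc.IH[of "\<lambda>j. c (Suc j)" "\<lambda>j. d (Suc j)" i] Suc.prems s by simp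
  qed (use 0 in simp)
qed simp

lemma weight_exponent_count:
  "set js \<subseteq> {..<N} \<Longrightarrow> weight_exponent M js = (\<Sum>j<N. count_list js j * M ^ j)"
proof (induction js)
  case (Cons a js)
  have "(\<Sum>j<N. count_list (a # js) j * M ^ j) = (\<Sum>j<N. (if j = a then M ^ j else 0) + count_list js j * M ^ j)"
    by (rule sum.cong) auto
  also have "\<dots> = M ^ a + (\<Sum>j<N. count_list js j * M ^ j)"
    using Cons.prems by (simp add: sum.distrib)
  finally show ?case using Cons by (simp add: weight_exponent_def)
qed (simp add: weight_exponent_def)

text \<open>Lengths below \<open>M\<close> make the multiplicities genuine base-M digits; these
  determine the multiset, and sortedness the list.\<close>

lemma weight_exponent_inj:
  assumes "sorted js" "sorted ks" "length js < M" "length ks < M" "weight_exponent M js = weight_exponent M ks"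
  shows "js = ks"
proof -
  obtain N where N: "set js \<subseteq> {..<N}" "set ks \<subseteq> {..<N}"
    using finite_nat_set_iff_bounded[of "set js \<union> set ks"] by auto
  have lt: "count_list js j < M" "count_list ks j < M" for j
    using count_le_length[of js j] count_le_length[of ks j] assms by linarith+
  have eq: "(\<Sum>j<N. count_list js j * M ^ j) = (\<Sum>j<N. count_list ks j * M ^ j)"
    using assms(5) weight_exponent_count[OF N(1), of M] weight_exponent_count[OF N(2), of M] by simp
  have "count_list js j = count_list ks j" for j
  proof (cases "j < N")
    case True
    then show ?thesis using digits_unique[OF lt eq] by blast
  next
    case False
    then show ?thesis using N by (metis count_notin lessThan_iff subsetD)
  qed
  then have "mset js = mset ks" by (simp add: multiset_eq_iff count_mset)
  then show ?thesis using assms(1,2) by (metis properties_for_sort)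
qed

lemma tendsto_power_ratio:
  assumes "a < b"
  shows "(\<lambda>t. (of_nat t :: complex) ^ a / of_nat t ^ b) \<longlonglongrightarrow> 0"
proof -
  have "(\<lambda>t. inverse (of_nat t :: complex) ^ (b - a)) \<longlonglongrightarrow> 0 ^ (b - a)"
    by (intro tendsto_intros lim_inverse_n)
  moreover have "(0 :: complex) ^ (b - a) = 0" using assms by simp
  ultimately have "(\<lambda>t. inverse (of_nat t :: complex) ^ (b - a)) \<longlonglongrightarrow> 0"
    by (simp only:)
  moreover have "\<forall>\<^sub>F t in sequentially. inverse (of_nat t :: complex) ^ (b - a) = of_nat t ^ a / of_nat t ^ b"
    using eventually_gt_at_top[of 0]
  proof eventually_elim
    case (elim t)
    have "(of_nat t :: complex) ^ b = of_nat t ^ a * of_nat t ^ (b - a)"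
      using assms by (simp flip: power_add)
    then show ?case using elim by (simp add: field_simps)
  qed
  ultimately show ?thesis by (rule Lim_transform_eventually)
qed

text \<open>At the point \<open>id\<close> each normal form b contributes t^(ex b) times a factor
  with a finite limit. If g acted by zero on all generic modules, the sum divided by the top power
  of t would vanish for all large t, while its limit is a nonzero coefficient of g.\<close>

lemma ps_faithful:
  assumes keys: "Poly_Mapping.keys g \<subseteq> nf_basis n" and "g \<noteq> 0"
  shows "\<exists>\<chi> \<tau>. generic n \<chi> \<and> \<tau> \<in> word_perms n \<and> act (ps_op \<chi>) g (point_mass \<tau>) \<noteq> (\<lambda>\<sigma>. 0)"
proof (rule ccontr)
  assume "\<not> ?thesis"
  then have zero: "act (ps_op \<chi>) g (point_mass \<tau>) \<sigma> = 0" if "generic n \<chi>" "\<tau> \<in> word_perms n" for \<chi> \<tau> \<sigma>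
    using that by (metis (no_types))
  let ?B = "Poly_Mapping.keys g"
  have "\<forall>b\<in>?B. \<exists>js w. b = Word (map Y js @ map S w) \<and> sorted js \<and> w \<in> nf_words n"
    using keys by (fastforce simp: nf_basis_def)
  then obtain Js Ws where b: "\<And>b. b \<in> ?B \<Longrightarrow> b = Word (map Y (Js b) @ map S (Ws b))"
    "\<And>b. b \<in> ?B \<Longrightarrow> sorted (Js b)" "\<And>b. b \<in> ?B \<Longrightarrow> Ws b \<in> nf_words n"
    by metis
  \<comment> \<open>Exceeding all lengths prevents carries between digits; the summand 2 gives M
    \<ge> 2, which the gaps between weights require.\<close>
  define M where "M = 2 + Max ((\<lambda>b. length (Js b)) ` ?B)"
  have M: "2 \<le> M" "length (Js b) < M" if "b \<in> ?B" for b
  proof -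
    have "length (Js b) \<le> Max ((\<lambda>b. length (Js b)) ` ?B)" using that by (intro Max_ge) auto
    then show "2 \<le> M" "length (Js b) < M" unfolding M_def by linarith+
  qed
  define ex where "ex b = weight_exponent M (Js b)" for b
  have "?B \<noteq> {}" using \<open>g \<noteq> 0\<close> by simp
  \<comment> \<open>\<open>b0\<close> grows fastest; testing on its permutation \<open>\<tau>\<close> kills the other words with the same monomial\<close>
  then have "Max (ex ` ?B) \<in> ex ` ?B" by (intro Max_in) auto
  then obtain b0 where b0: "b0 \<in> ?B" "\<And>b. b \<in> ?B \<Longrightarrow> ex b \<le> ex b0"
    by (metis Max_ge finite_imageI finite_keys imageE imageI)
  define \<tau> where "\<tau> = word_perm (Ws b0)"
  have \<tau>: "\<tau> \<in> word_perms n"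
    using comp_word_perm_in_word_perms[OF word_perms.id set_nf_words[OF b(3)[OF b0(1)]]] by (simp add: \<tau>_def)
  \<comment> \<open>Evaluating at \<open>id\<close> makes the y part a pure power of t, and the
    limit of the s part is 0 or 1.\<close>
  define L where "L b t = foldr (ps_op (growing_weight M t)) (map S (Ws b)) (point_mass \<tau>) id" for b t
  have L: "L b \<longlonglongrightarrow> point_mass \<tau> (word_perm (Ws b))" for b
    unfolding L_def[abs_def]
    using tendsto_ps_word[of id M "Ws b" "point_mass \<tau>"] M(1)[OF b0(1)] by simp
  let ?r = "\<lambda>b t. (of_nat t :: complex) ^ ex b / of_nat t ^ ex b0"
  have "(\<lambda>t. Poly_Mapping.lookup g b * (?r b t * L b t)) \<longlonglongrightarrow> (if b = b0 then Poly_Mapping.lookup g b0 else 0)"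
    if "b \<in> ?B" for b
  proof (cases "ex b = ex b0")
    case True
    have "Js b = Js b0"
      using weight_exponent_inj[of "Js b" "Js b0" M] True that b0(1) b M by (simp add: ex_def)
    have "(\<lambda>t. ?r b t) \<longlonglongrightarrow> 1"
    proof (rule tendsto_eventually)
      show "\<forall>\<^sub>F t in sequentially. ?r b t = 1"
        using eventually_gt_at_top[of 0] by eventually_elim (simp add: True)
    qed
    then have lim: "(\<lambda>t. Poly_Mapping.lookup g b * (?r b t * L b t)) \<longlonglongrightarrow>
        Poly_Mapping.lookup g b * (1 * point_mass \<tau> (word_perm (Ws b)))"
      by (intro tendsto_intros L)
    show ?thesis
    proof (cases "b = b0")
      case False
      then have "Ws b \<noteq> Ws b0" using b(1)[OF that] b(1)[OF b0(1)] \<open>Js b = Js b0\<close> by metis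
      then have "word_perm (Ws b) \<noteq> \<tau>"
        using inj_on_word_perm[of n] b(3)[OF that] b(3)[OF b0(1)] by (auto simp: inj_on_def \<tau>_def)
      then show ?thesis using lim False by (simp add: point_mass_def)
    qed (use lim in \<open>simp add: point_mass_def \<tau>_def\<close>)
  next
    case False
    then have "ex b < ex b0" using b0(2)[OF that] by simp
    then have "(\<lambda>t. Poly_Mapping.lookup g b * (?r b t * L b t)) \<longlonglongrightarrow>
        Poly_Mapping.lookup g b * (0 * point_mass \<tau> (word_perm (Ws b)))"
      by (intro tendsto_intros L tendsto_power_ratio)
    then show ?thesis using False by auto
  qed
  then have "(\<lambda>t. \<Sum>b\<in>?B. Poly_Mapping.lookup g b * (?r b t * L b t)) \<longlonglongrightarrow>
      (\<Sum>b\<in>?B. if b = b0 then Poly_Mapping.lookup g b0 else 0)"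
    by (rule tendsto_sum)
  then have lim: "(\<lambda>t. \<Sum>b\<in>?B. Poly_Mapping.lookup g b * (?r b t * L b t)) \<longlonglongrightarrow> Poly_Mapping.lookup g b0"
    using b0(1) by simp
  \<comment> \<open>From t = 3 on the weight is generic, so the sum is a scaled value of the action
    of g and vanishes exactly.\<close>
  have "\<forall>\<^sub>F t in sequentially. (\<Sum>b\<in>?B. Poly_Mapping.lookup g b * (?r b t * L b t)) = 0"
    using eventually_ge_at_top[of 3]
  proof eventually_elim
    case (elim t)
    have word: "foldr (ps_op (growing_weight M t)) (letters b) (point_mass \<tau>) id = of_nat t ^ ex b * L b t"
      if "b \<in> ?B" for b
      using b(1)[OF that] ps_Y_word[of "growing_weight M t" "Js b" "map S (Ws b)" "point_mass \<tau>" id]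
      by (metis (no_types, lifting) L_def ex_def free_monoid.sel id_apply map_cong prod_list_growing_weight)
    have "(\<Sum>b\<in>?B. Poly_Mapping.lookup g b * (?r b t * L b t)) =
        (\<Sum>b\<in>?B. Poly_Mapping.lookup g b * (of_nat t ^ ex b * L b t)) / of_nat t ^ ex b0"
      by (simp add: sum_divide_distrib)
    also have "(\<Sum>b\<in>?B. Poly_Mapping.lookup g b * (of_nat t ^ ex b * L b t)) =
        act (ps_op (growing_weight M t)) g (point_mass \<tau>) id"
      unfolding act_def by (rule sum.cong) (simp_all add: word)
    also have "\<dots> = 0"
      using M(1)[OF b0(1)] elim by (intro zero generic_growing_weight \<tau>)
    finally show ?case by simp
  qed
  then have "(\<lambda>t. \<Sum>b\<in>?B. Poly_Mapping.lookup g b * (?r b t * L b t)) \<longlonglongrightarrow> 0"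
    by (rule tendsto_eventually)
  then have "Poly_Mapping.lookup g b0 = 0" using lim LIMSEQ_unique by blast
  then show False using b0(1) by (simp add: in_keys_iff)
qed

section \<open>The Jacobson radical\<close>

text \<open>For n > 1 the preimage of (e_1) in the free algebra, where normal forms and module
  actions are both defined on polynomials.\<close>

definition e_ideal :: "nat \<Rightarrow> (generator free_monoid \<Rightarrow>\<^sub>0 complex) set" where
  "e_ideal n = Idl\<^bsub>free_algebra (generators n)\<^esub> (insert (ge 1) {a - b |a b. (a, b) \<in> relations n})"

lemma e_ideal_generators_carrier:
  assumes "n > 1"
  shows "insert (ge 1) {a - b |a b. (a, b) \<in> relations n} \<subseteq> carrier (free_algebra (generators n))"
  using assms by (auto intro!: free_algebra_closed dest: relations_carrier)

lemma e_ideal_minimal: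
  assumes "ideal I (free_algebra (generators n))" "ge 1 \<in> I" "\<And>a b. (a, b) \<in> relations n \<Longrightarrow> a - b \<in> I"
  shows "e_ideal n \<subseteq> I"
  unfolding e_ideal_def using assms by (intro ring.genideal_minimal[OF ring_free_algebra]) auto

text \<open>e_(i+1) = - e_(i+1) e_i e_(i+1) brings every e_i into the ideal, starting from
  e_1.\<close>

lemma hecke_ideal_e_ideal:
  assumes "n > 1"
  shows "hecke_ideal n (e_ideal n)"
proof -
  note carr = e_ideal_generators_carrier[OF assms]
  have I: "ideal (e_ideal n) (free_algebra (generators n))"
    unfolding e_ideal_def by (rule ring.genideal_ideal[OF ring_free_algebra carr])
  note closed = ideal_free_algebra_closed[OF I]
  have gen: "ge 1 \<in> e_ideal n" "(a, b) \<in> relations n \<Longrightarrow> a - b \<in> e_ideal n" for a b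
    using ring.genideal_self[OF ring_free_algebra carr] unfolding e_ideal_def by blast+
  have "ge i \<in> e_ideal n" if "1 \<le> i" "i < n" for i
    using that
  proof (induction i rule: dec_induct)
    case base
    show ?case by (rule gen)
  next
    case (step i)
    have "ge (i+1) * ge i * ge (i+1) - - ge (i+1) \<in> e_ideal n"
      using step by (intro gen e_e_e_up) auto
    moreover have "ge (i+1) * ge i * ge (i+1) \<in> e_ideal n"
      using step by (intro closed(7)[OF closed(6)] free_algebra_closed(6)) auto
    ultimately show ?case using closed(5) by fastforce
  qed
  with I gen show ?thesis by (intro hecke_ideal.intro) auto
qed

lemma ideal_to_V_vimage:
  assumes "ideal I (\<V> n)"
  shows "ideal {f \<in> carrier (free_algebra (generators n)). to_V n f \<in> I} (free_algebra (generators n))"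
proof -
  interpret I: ideal I "\<V> n" by (rule assms)
  show ?thesis
    by (rule ideal_free_algebraI)
      (auto simp: to_V_simps to_V_zero intro: free_algebra_carrier to_V_closed
        I.I_l_closed I.I_r_closed I.a_closed I.zero_closed)
qed

lemma to_V_e_ideal:
  assumes "n > 1" "f \<in> e_ideal n"
  shows "to_V n f \<in> Idl\<^bsub>\<V> n\<^esub> {e_V n 1}"
proof -
  let ?F = "free_algebra (generators n)" and ?I = "Idl\<^bsub>\<V> n\<^esub> {e_V n 1}"
  have e: "e_V n 1 \<in> carrier (\<V> n)" using assms by (intro e_V_closed) auto
  interpret V: ring "\<V> n" by (rule ring_V)
  have I: "ideal ?I (\<V> n)" using e by (intro V.genideal_ideal) auto
  have "e_ideal n \<subseteq> {f \<in> carrier ?F. to_V n f \<in> ?I}"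
  proof (rule e_ideal_minimal[OF ideal_to_V_vimage[OF I]])
    show "ge 1 \<in> {f \<in> carrier ?F. to_V n f \<in> ?I}"
      using assms V.genideal_self'[OF e] by (auto simp: e_V_def intro: free_algebra_closed)
    fix a b assume ab: "(a, b) \<in> relations n"
    then have "a - b \<in> relation_ideal n" and c: "a - b \<in> carrier ?F"
      using relations_carrier[OF ab] to_V_relations[OF ab] to_V_eq_iff[of a n b]
      by (auto intro: free_algebra_closed)
    then have "to_V n (a - b) = to_V n 0" using to_V_eq_iff[of "a - b" n 0] by (simp add: free_algebra_closed)
    moreover have "\<zero>\<^bsub>\<V> n\<^esub> \<in> ?I"
      using I by (intro additive_subgroup.zero_closed) (simp add: ideal_def)
    ultimately show "a - b \<in> {f \<in> carrier ?F. to_V n f \<in> ?I}" using c by (simp add: to_V_zero)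
  qed
  then show ?thesis using assms(2) by blast
qed

text \<open>A representative f and its normal form g differ by an element that acts by zero on every
  generic principal series module. Since f kills the point masses there, so does g, and
  \<open>ps_faithful\<close> leaves only g = 0.\<close>

lemma jacobson_radical_subset:
  assumes "n > 1"
  shows "jacobson_radical (\<V> n) \<subseteq> Idl\<^bsub>\<V> n\<^esub> {e_V n 1}"
proof
  fix X assume X: "X \<in> jacobson_radical (\<V> n)"
  interpret H: hecke_ideal n "e_ideal n" by (rule hecke_ideal_e_ideal[OF assms])
  have "X \<in> carrier (\<V> n)" using X by (simp add: jacobson_radical_def)
  then obtain f where f: "f \<in> carrier (free_algebra (generators n))" "X = to_V n f"
    by (rule carrier_V_cases)
  obtain g where g: "Poly_Mapping.keys g \<subseteq> nf_basis n" "f - g \<in> e_ideal n"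
    using H.reducible_carrier[OF f(1)] by (auto simp: H.reducible_def)
  have "g = 0"
  proof (rule ccontr)
    assume "g \<noteq> 0"
    then obtain \<chi> \<tau> where \<chi>: "generic n \<chi>" and \<tau>: "\<tau> \<in> word_perms n"
      and nz: "act (ps_op \<chi>) g (point_mass \<tau>) \<noteq> (\<lambda>\<sigma>. 0)"
      using ps_faithful[OF g(1)] by blast
    interpret V_module "ps_op \<chi>" n "ps_space n" by (rule V_module_ps[OF generic_inj[OF \<chi>]])
    have "e_ideal n \<subseteq> annihilator"
      using assms by (intro e_ideal_minimal ideal_annihilator ge_in_ps_annihilator[OF \<chi>] diff_relations_annihilator) auto
    then have "act (ps_op \<chi>) (f - g) (point_mass \<tau>) = (\<lambda>\<sigma>. 0)"
      using g(2) point_mass_in_ps_space[OF \<chi> \<tau>] by (auto simp: annihilator_def)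
    moreover have "act (ps_op \<chi>) f (point_mass \<tau>) = (\<lambda>\<sigma>. 0)"
      using jacobson_radical_ps[OF \<chi> f(1) _ \<tau>] X f(2) by simp
    ultimately show False using nz by (auto simp: act_diff fun_eq_iff)
  qed
  then show "X \<in> Idl\<^bsub>\<V> n\<^esub> {e_V n 1}" using g f to_V_e_ideal[OF assms] by simp
qed

theorem lemma18:
  fixes n :: nat
  assumes "n > 2"
  shows "jacobson_radical (\<V> n) \<subset> Idl\<^bsub>\<V> n\<^esub> {e_V n 1}"
proof
  show "jacobson_radical (\<V> n) \<subseteq> Idl\<^bsub>\<V> n\<^esub> {e_V n 1}"
    using assms by (intro jacobson_radical_subset) simp
  have "e_V n 1 \<in> Idl\<^bsub>\<V> n\<^esub> {e_V n 1}"
    using assms by (intro ring.genideal_self'[OF ring_V] e_V_closed) auto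
  then show "jacobson_radical (\<V> n) \<noteq> Idl\<^bsub>\<V> n\<^esub> {e_V n 1}"
    using e_V_not_in_jacobson_radical[OF assms] by auto
qed

end
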